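(* Let $K\subset\mathbb{R}^d$ be a cone. Every compact $K$-irreducible set $\mathcal{A}$ of $K$-Metzler operators possesses an invariant monotone norm on the cone $K$.
   Context: Every cone is convex, closed, solid, pointed, with apex at the origin. $x\ge_K y$ means $x-y\in K$. A linear operator $A$ on $\mathbb{R}^d$ is $K$-Metzler if there is $h>0$ with $(I+hA)K\subset K$. A face of $K$ is the intersection of $K$ with a supporting hyperplane through the apex; the face $\{0\}$ is trivial, all others are nontrivial; a face plane is the linear span of a face. A family of $K$-Metzler operators is $K$-irreducible if no nontrivial face plane of $K$ is invariant for all operators of the family. A norm on $K$ is a function $\|\cdot\|:K\to[0,\infty)$ that is convex, positively homogeneous, and positive on $K\setminus\{0\}$. It is monotone if $x,y\in K$, $x\ge_K y$ imply $\|x\|\ge\|y\|$. A trajectory is a solution $x(\cdot)$ of $\dot x(t)=A(t)x(t)$, $t\ge0$, with $A(\cdot)$ a measurable function with values in $\mathcal{A}$; a generalized trajectory is a solution with $A(\cdot)$ measurable with values in the convex hull $\mathrm{co}(\mathcal{A})$. (For $K$-Metzler operators trajectories starting in $K$ stay in $K$.) The Lyapunov exponent $\sigma=\sigma(\mathcal{A})$ is the infimum of $\alpha$ such that $\|x(t)\|\le Ce^{\alpha t}$ for every trajectory. A norm on $K$ is extremal for $\mathcal{A}$ if $\|x(t)\|\le e^{\sigma t}\|x(0)\|$, $t\ge0$, for every trajectory starting in $K$. An extremal norm is invariant if for every $x_0\in K$ there is a generalized trajectory $\bar x(\cdot)$ with $\bar x(0)=x_0$ and $\|\bar x(t)\|=e^{\sigma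 t}\|x_0\|$ for all $t\ge0$. *)

theory Defs
  imports "HOL-Analysis.Analysis"
begin

(* Linear operators on R^d are represented by matrices of type real^'d^'d acting by *v. *)

definition proper_cone :: "(real^'d) set \<Rightarrow> bool" where
  "proper_cone K \<longleftrightarrow>
     cone K \<and> convex K \<and> closed K \<and> interior K \<noteq> {} \<and> K \<inter> uminus ` K = {0}"

definition cone_le :: "(real^'d) set \<Rightarrow> real^'d \<Rightarrow> real^'d \<Rightarrow> bool" where
  "cone_le K y x \<longleftrightarrow> x - y \<in> K"

definition metzler :: "(real^'d) set \<Rightarrow> real^'d^'d \<Rightarrow> bool" where
  "metzler K A \<longleftrightarrow> (\<exists>h>0. (\<lambda>x. (mat 1 + h *\<^sub>R A) *v x) ` K \<subseteq> K)"

(* The library's exposed_face_of is not used: it also admits a = 0 (so that K itself would be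
   a face) and hyperplanes missing K (so that the empty set would be a face). *)
definition cone_face :: "(real^'d) set \<Rightarrow> (real^'d) set \<Rightarrow> bool" where
  "cone_face K F \<longleftrightarrow>
     (\<exists>p. p \<noteq> 0 \<and> (\<forall>x\<in>K. 0 \<le> p \<bullet> x) \<and> F = K \<inter> {x. p \<bullet> x = 0})"

definition nontrivial_face_plane :: "(real^'d) set \<Rightarrow> (real^'d) set \<Rightarrow> bool" where
  "nontrivial_face_plane K V \<longleftrightarrow> (\<exists>F. cone_face K F \<and> F \<noteq> {0} \<and> V = span F)"

definition cone_irreducible :: "(real^'d) set \<Rightarrow> (real^'d^'d) set \<Rightarrow> bool" where
  "cone_irreducible K \<A> \<longleftrightarrow>
     \<not> (\<exists>V. nontrivial_face_plane K V \<and> (\<forall>A\<in>\<A>. (\<lambda>x. A *v x) ` V \<subseteq> V))"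

(* Values of N outside K are irrelevant. *)
definition norm_on_cone :: "(real^'d) set \<Rightarrow> (real^'d \<Rightarrow> real) \<Rightarrow> bool" where
  "norm_on_cone K N \<longleftrightarrow>
     (\<forall>x\<in>K. 0 \<le> N x) \<and>
     convex_on K N \<and>
     (\<forall>x\<in>K. \<forall>c\<ge>0. N (c *\<^sub>R x) = c * N x) \<and>
     (\<forall>x\<in>K - {0}. 0 < N x)"

definition monotone_on_cone :: "(real^'d) set \<Rightarrow> (real^'d \<Rightarrow> real) \<Rightarrow> bool" where
  "monotone_on_cone K N \<longleftrightarrow> (\<forall>x\<in>K. \<forall>y\<in>K. cone_le K y x \<longrightarrow> N y \<le> N x)"

(* Caratheodory solutions on [0, oo): x' = A(t) x holds almost everywhere and x is locally
   absolutely continuous, i.e. x is an indefinite Lebesgue integral of A(.) x(.). *)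
definition ode_solution :: "(real \<Rightarrow> real^'d^'d) \<Rightarrow> (real \<Rightarrow> real^'d) \<Rightarrow> bool" where
  "ode_solution A x \<longleftrightarrow>
     (\<forall>t\<ge>0. (\<lambda>s. A s *v x s) absolutely_integrable_on {0..t} \<and>
            x t = x 0 + integral {0..t} (\<lambda>s. A s *v x s))"

definition trajectory :: "(real^'d^'d) set \<Rightarrow> (real \<Rightarrow> real^'d) \<Rightarrow> bool" where
  "trajectory \<A> x \<longleftrightarrow>
     (\<exists>A. A \<in> borel_measurable (lebesgue_on {0..}) \<and> (\<forall>t\<ge>0. A t \<in> \<A>) \<and> ode_solution A x)"

definition generalized_trajectory :: "(real^'d^'d) set \<Rightarrow> (real \<Rightarrow> real^'d) \<Rightarrow> bool" where
  "generalized_trajectory \<A> x \<longleftrightarrow> trajectory (convex hull \<A>) x"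

(* The constant C depends on the trajectory (in particular on x(0)). The infimum is a genuine
   real number whenever the set of operators is bounded and nonempty. *)
definition lyapunov_exponent :: "(real^'d^'d) set \<Rightarrow> real" where
  "lyapunov_exponent \<A> =
     Inf {\<alpha>. \<forall>x. trajectory \<A> x \<longrightarrow> (\<exists>C. \<forall>t\<ge>0. norm (x t) \<le> C * exp (\<alpha> * t))}"

definition extremal_norm ::
    "(real^'d) set \<Rightarrow> (real^'d^'d) set \<Rightarrow> (real^'d \<Rightarrow> real) \<Rightarrow> bool" where
  "extremal_norm K \<A> N \<longleftrightarrow>
     norm_on_cone K N \<and>
     (\<forall>x. trajectory \<A> x \<and> x 0 \<in> K \<longrightarrow>
        (\<forall>t\<ge>0. N (x t) \<le> exp (lyapunov_exponent \<A> * t) * N (x 0)))"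

definition invariant_norm ::
    "(real^'d) set \<Rightarrow> (real^'d^'d) set \<Rightarrow> (real^'d \<Rightarrow> real) \<Rightarrow> bool" where
  "invariant_norm K \<A> N \<longleftrightarrow>
     extremal_norm K \<A> N \<and>
     (\<forall>x0\<in>K. \<exists>x. generalized_trajectory \<A> x \<and> x 0 = x0 \<and>
        (\<forall>t\<ge>0. N (x t) = exp (lyapunov_exponent \<A> * t) * N x0))"

end

theory Submission
  imports Defs "HOL-Complex_Analysis.Great_Picard"
begin

text \<open>The flow maps of the measurable controls form a semigroup of linear maps preserving the cone. Irreducibility says that no orbit stays in the zero set of a nonzero functional of the dual cone: otherwise the functionals vanishing on the orbit form a convex cone that is invariant under the adjoint flow, and a point in its relative interior exposes an invariant face. By compactness, every point can then be steered uniformly, so that the maximal growth \<open>F t\<close> is attained up to a constant from every point of the cone; hence \<open>F t\<close> is comparable to \<open>exp (\<sigma> * t)\<close>. Following Barabanov, the norm is the upper limit as time tends to infinity of the largest value of \<open>exp (- \<sigma> * t) * (e \<bullet> x t)\<close> over all trajectories from the given point, where \<open>e\<close> is a strictly positive functional; monotonicity is inherited from \<open>e\<close>. Trajectories on the unit interval that almost attain the norm have a limit that solves the equation with a control in the convex hull, and concatenating such limits gives the trajectories on which the norm grows exactly like \<open>exp (\<sigma> * t)\<close>.\<close>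

section \<open>Linear equations with measurable bounded controls\<close>

text \<open>Controls are merely measurable, so no derivative of a solution is available at a given
  time; growth and invariance estimates come from Euler steps with an averaged operator and an error
  quadratic in the step. The family need not be convex, so its trajectories need not attain extremal
  values; the norm is defined by suprema over these trajectories, and the convex hull enters only
  when a limit is taken. A supremum over all times would give an extremal norm but not an invariant
  one: near-optimality must occur so late that dropping an initial unit of time leaves an admissible
  competitor, hence the upper limit. The comparison of \<open>F t\<close> with the exponential makes
  this limit finite and positive. It needs no limit of \<open>F t\<close>: a small value at one time
  would force all trajectories to grow more slowly than the exponent allows, and a large value can
  be repeated period after period.\<close>

lemma bounded_bilinear_matrix_vector_mult:
  "bounded_bilinear (\<lambda>(A::real^'n^'m) x. A *v x)"
  by (rule bilinear_conv_bounded_bilinear[THEN iffD1])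
    (auto simp: bilinear_def linear_iff matrix_vector_mult_add_rdistrib matrix_vector_right_distrib
      scaleR_matrix_vector_assoc matrix_vector_mult_scaleR)

lemma convex_norm_mult_vec_le:
  fixes v :: "real^'n"
  shows "convex {Y :: real^'n^'m. norm (Y *v v) \<le> c}"
proof (rule convexI, unfold mem_Collect_eq)
  fix X Y :: "real^'n^'m" and a b :: real
  assume XY: "norm (X *v v) \<le> c" "norm (Y *v v) \<le> c" and ab: "0 \<le> a" "0 \<le> b" "a + b = 1"
  have "norm ((a *\<^sub>R X + b *\<^sub>R Y) *v v) \<le> a * norm (X *v v) + b * norm (Y *v v)"
    using ab norm_triangle_ineq[of "a *\<^sub>R (X *v v)" "b *\<^sub>R (Y *v v)"]
    unfolding matrix_vector_mult_add_rdistrib scaleR_matrix_vector_assoc[symmetric] by simp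
  also have "\<dots> \<le> a * c + b * c"
    using XY ab by (intro add_mono mult_left_mono) auto
  finally show "norm ((a *\<^sub>R X + b *\<^sub>R Y) *v v) \<le> c" using ab by (metis distrib_right mult_1)
qed

text \<open>Over \<open>n + 1\<close> equal steps the quadratic errors add up to
  \<open>C * T\<^sup>2 / (n + 1)\<close>, which vanishes in the limit. This stands in for the rule
  that a nonpositive derivative implies decrease, without any differentiability of
  \<open>g\<close>.\<close>

lemma le_of_quadratic_increments:
  fixes g :: "real \<Rightarrow> real"
  assumes "0 \<le> T" and step: "\<And>s t. 0 \<le> s \<Longrightarrow> s < t \<Longrightarrow> t \<le> T \<Longrightarrow> g t \<le> g s + C * (t - s)\<^sup>2"
  shows "g T \<le> g 0"
proof (cases "T = 0")
  case False
  with assms(1) have T: "T > 0" by simp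
  have "g T \<le> g 0 + C * T\<^sup>2 / real (Suc n)" for n
  proof -
    define h where "h = T / real (Suc n)"
    have h: "h > 0" using T by (simp add: h_def)
    have hn: "h * real (Suc n) = T" by (simp add: h_def)
    have "g (real k * h) \<le> g 0 + real k * (C * h\<^sup>2)" if "k \<le> Suc n" for k
      using that
    proof (induction k)
      case (Suc k)
      have "real (Suc k) * h \<le> real (Suc n) * h"
        using Suc.prems h by (intro mult_right_mono) auto
      then have le: "real (Suc k) * h \<le> T" using hn by (simp add: mult.commute)
      have "g (real (Suc k) * h) \<le> g (real k * h) + C * (real (Suc k) * h - real k * h)\<^sup>2"
        using h le by (intro step) (auto simp: algebra_simps)
      also have "real (Suc k) * h - real k * h = h" by (simp add: algebra_simps)
      finally show ?case using Suc by (simp add: algebra_simps)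
    qed simp
    from this[of "Suc n"] have "g T \<le> g 0 + real (Suc n) * (C * h\<^sup>2)"
      using hn by (simp add: mult.commute)
    also have "real (Suc n) * (C * h\<^sup>2) = C * T\<^sup>2 / real (Suc n)"
      using hn h by (simp add: h_def power2_eq_square)
    finally show ?thesis .
  qed
  moreover have "(\<lambda>n. g 0 + C * T\<^sup>2 / real (Suc n)) \<longlonglongrightarrow> g 0 + 0"
    by (intro tendsto_intros LIMSEQ_Suc[OF lim_const_over_n])
  ultimately show ?thesis
    using LIMSEQ_le_const[of "\<lambda>n. g 0 + C * T\<^sup>2 / real (Suc n)" "g 0" "g T"] by auto
qed simp

text \<open>Multiplying by \<open>exp (- c * t)\<close> removes the linear term and leaves quadratic
  increments. Neither \<open>c\<close> nor \<open>\<psi>\<close> has a sign: the absolute value in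
  the error constant covers negative \<open>c\<close>, and lower bounds follow by applying the
  estimate to a negative function.\<close>

lemma exp_bound_of_quadratic_steps:
  fixes \<psi> :: "real \<Rightarrow> real"
  assumes "0 \<le> T" "0 \<le> C"
    and step: "\<And>s h. 0 \<le> s \<Longrightarrow> 0 < h \<Longrightarrow> s + h \<le> T \<Longrightarrow> \<psi> (s + h) \<le> exp (c * h) * \<psi> s + C * h\<^sup>2"
  shows "\<psi> T \<le> exp (c * T) * \<psi> 0"
proof -
  have "exp (- c * T) * \<psi> T \<le> exp (- c * 0) * \<psi> 0"
  proof (rule le_of_quadratic_increments[where C = "C * exp (\<bar>c\<bar> * T)"])
    fix s t assume st: "0 \<le> s" "s < t" "t \<le> T"
    have "\<psi> t \<le> exp (c * (t - s)) * \<psi> s + C * (t - s)\<^sup>2"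
      using step[of s "t - s"] st by simp
    then have "exp (- c * t) * \<psi> t \<le> exp (- c * t) * (exp (c * (t - s)) * \<psi> s + C * (t - s)\<^sup>2)"
      by (intro mult_left_mono) auto
    also have "\<dots> = exp (- c * s) * \<psi> s + exp (- c * t) * (C * (t - s)\<^sup>2)"
      by (simp add: algebra_simps exp_diff exp_minus field_simps)
    also have "exp (- c * t) * (C * (t - s)\<^sup>2) \<le> exp (\<bar>c\<bar> * T) * (C * (t - s)\<^sup>2)"
    proof (rule mult_right_mono)
      have "- c * t \<le> \<bar>c\<bar> * t" using st by (intro mult_right_mono) auto
      also have "\<dots> \<le> \<bar>c\<bar> * T" using st by (intro mult_left_mono) auto
      finally show "exp (- c * t) \<le> exp (\<bar>c\<bar> * T)" by simp
    qed (use assms in auto)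
    finally show "exp (- c * t) * \<psi> t \<le> exp (- c * s) * \<psi> s + C * exp (\<bar>c\<bar> * T) * (t - s)\<^sup>2"
      by (simp add: mult_ac)
  qed (use assms in auto)
  then show ?thesis by (simp add: exp_minus field_simps)
qed

text \<open>Controls are total functions on the real line, so that shifting and concatenating them needs no domain bookkeeping.\<close>

definition control :: "(real^'d^'d) set \<Rightarrow> (real \<Rightarrow> real^'d^'d) \<Rightarrow> bool" where
  "control \<B> A \<longleftrightarrow> A \<in> borel_measurable lebesgue \<and> range A \<subseteq> \<B>"

text \<open>The horizon is finite because limits of trajectories are taken on compact intervals.
  Continuity of \<open>x\<close> replaces the integrability required by \<open>ode_solution\<close>
  and implies it for bounded controls. For negative \<open>T\<close> the condition is
  vacuous.\<close>

definition solves_on :: "real \<Rightarrow> (real \<Rightarrow> real^'d^'d) \<Rightarrow> (real \<Rightarrow> real^'d) \<Rightarrow> bool" where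
  "solves_on T A x \<longleftrightarrow> continuous_on {0..T} x \<and>
     (\<forall>t\<in>{0..T}. x t = x 0 + integral {0..t} (\<lambda>s. A s *v x s))"

lemma solves_on_continuous: "solves_on T A x \<Longrightarrow> 0 \<le> s \<Longrightarrow> t \<le> T \<Longrightarrow> continuous_on {s..t} x"
  unfolding solves_on_def by (rule continuous_on_subset[of "{0..T}"]) auto

lemma solves_on_eq:
  "solves_on T A x \<Longrightarrow> 0 \<le> t \<Longrightarrow> t \<le> T \<Longrightarrow> x t = x 0 + integral {0..t} (\<lambda>s. A s *v x s)"
  unfolding solves_on_def by (metis atLeastAtMost_iff)

text \<open>The bound is imposed on each \<open>A *v x\<close> because it is then a convex condition
  on \<open>A\<close>, so that the convex hull inherits the same \<open>M\<close>. Boundedness in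
  the matrix norm serves to integrate a control by itself.\<close>

locale bounded_operators =
  fixes \<B> :: "(real^'d^'d) set" and M :: real
  assumes M_nonneg: "0 \<le> M" and M_bound: "\<And>A x. A \<in> \<B> \<Longrightarrow> norm (A *v x) \<le> M * norm x"
    and bounded: "bounded \<B>"
begin

lemma M_control: "control \<B> A \<Longrightarrow> norm (A s *v x) \<le> M * norm x"
  by (rule M_bound) (auto simp: control_def)

lemma bounded_operators_convex_hull: "bounded_operators (convex hull \<B>) M"
proof
  show "norm (A *v x) \<le> M * norm x" if "A \<in> convex hull \<B>" for A x
  proof -
    have "convex hull \<B> \<subseteq> {Y. norm (Y *v x) \<le> M * norm x}"
      using M_bound by (intro hull_minimal convex_norm_mult_vec_le) auto
    then show ?thesis using that by blast
  qed
qed (use M_nonneg bounded bounded_convex_hull in auto)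

lemma control_integrable:
  assumes A: "control \<B> A" and x: "continuous_on {a..b} x"
  shows "(\<lambda>s. A s *v x s) absolutely_integrable_on {a..b}"
proof (rule measurable_bounded_by_integrable_imp_absolutely_integrable)
  have mA: "A \<in> borel_measurable (lebesgue_on {a..b})"
    using A by (auto simp: control_def intro: measurable_restrict_space1)
  have mx: "x \<in> borel_measurable (lebesgue_on {a..b})"
    using x by (intro continuous_imp_measurable_on_sets_lebesgue) auto
  show "(\<lambda>s. A s *v x s) \<in> borel_measurable (lebesgue_on {a..b})"
    by (rule borel_measurable_continuous_Pair[OF mA mx, of "\<lambda>A x. A *v x"])
      (intro bounded_bilinear.continuous_on[OF bounded_bilinear_matrix_vector_mult] continuous_intros)
  show "(\<lambda>s. M * norm (x s)) integrable_on {a..b}"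
    by (intro integrable_continuous_real continuous_intros x)
qed (use M_control[OF A] in auto)

lemma solves_on_increment:
  assumes A: "control \<B> A" and x: "solves_on T A x" and st: "0 \<le> s" "s \<le> t" "t \<le> T"
  shows "x t - x s = integral {s..t} (\<lambda>r. A r *v x r)"
proof -
  have "continuous_on {0..t} x"
    using solves_on_continuous[OF x] st by simp
  then have "(\<lambda>r. A r *v x r) integrable_on {0..t}"
    using control_integrable[OF A] by (auto simp: absolutely_integrable_on_def)
  from Henstock_Kurzweil_Integration.integral_combine[OF st(1,2) this]
  have c: "integral {0..s} (\<lambda>r. A r *v x r) + integral {s..t} (\<lambda>r. A r *v x r)
      = integral {0..t} (\<lambda>r. A r *v x r)" .
  have "x t = x 0 + integral {0..t} (\<lambda>r. A r *v x r)" "x s = x 0 + integral {0..s} (\<lambda>r. A r *v x r)"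
    by (intro solves_on_eq[OF x]; use st in simp)+
  with c show ?thesis by (simp add: algebra_simps)
qed

lemma solves_on_lipschitz:
  assumes A: "control \<B> A" and x: "solves_on T A x" and R: "\<And>s. s \<in> {0..T} \<Longrightarrow> norm (x s) \<le> R"
    and st: "0 \<le> s" "s \<le> t" "t \<le> T"
  shows "norm (x t - x s) \<le> M * R * (t - s)"
proof -
  have "continuous_on {s..t} x"
    using solves_on_continuous[OF x] st by simp
  then have i: "(\<lambda>r. A r *v x r) integrable_on {s..t}"
    using control_integrable[OF A] by (auto simp: absolutely_integrable_on_def)
  have "norm (integral {s..t} (\<lambda>r. A r *v x r)) \<le> integral {s..t} (\<lambda>r. M * R)"
  proof (rule integral_norm_bound_integral[OF i])
    fix r assume "r \<in> {s..t}"
    then have "norm (x r) \<le> R" using R st by auto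
    then show "norm (A r *v x r) \<le> M * R"
      using M_control[OF A, of r "x r"] M_nonneg by (meson mult_left_mono order_trans)
  qed auto
  then show ?thesis
    using solves_on_increment[OF A x st] st by (simp add: mult_ac)
qed

text \<open>If the mean lay outside \<open>C\<close>, a hyperplane would separate it strictly from
  \<open>C\<close>, and integrating that inequality over the interval gives a contradiction. So over
  a short time a control acts to first order like one operator from a closed convex set.\<close>

lemma control_average:
  assumes A: "control \<B> A" and C: "closed C" "convex C" "\<B> \<subseteq> C" and h: "0 < h"
  shows "A integrable_on {s..s+h}" "(1 / h) *\<^sub>R integral {s..s+h} A \<in> C"
proof -
  obtain R where R: "\<And>X. X \<in> \<B> \<Longrightarrow> norm X \<le> R" using bounded by (auto simp: bounded_iff)
  have "A absolutely_integrable_on {s..s+h}"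
  proof (rule measurable_bounded_by_integrable_imp_absolutely_integrable[where g = "\<lambda>_. R"])
    show "A \<in> borel_measurable (lebesgue_on {s..s+h})"
      using A by (auto simp: control_def intro: measurable_restrict_space1)
  qed (use A R in \<open>auto simp: control_def\<close>)
  then show i: "A integrable_on {s..s+h}" by (auto simp: absolutely_integrable_on_def)
  show "(1 / h) *\<^sub>R integral {s..s+h} A \<in> C"
  proof (rule ccontr)
    assume "(1 / h) *\<^sub>R integral {s..s+h} A \<notin> C"
    from separating_hyperplane_closed_point[OF C(2,1) this] obtain a b
      where ab: "a \<bullet> ((1 / h) *\<^sub>R integral {s..s+h} A) < b" "\<And>X. X \<in> C \<Longrightarrow> b < a \<bullet> X" by auto
    have "integral {s..s+h} (\<lambda>r. b) \<le> integral {s..s+h} (\<lambda>r. a \<bullet> A r)"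
    proof (rule integral_le)
      show "(\<lambda>r. a \<bullet> A r) integrable_on {s..s+h}"
        using integrable_linear[OF i bounded_linear_inner_right[of a]] by (simp add: o_def)
      fix r show "b \<le> a \<bullet> A r"
        using ab(2)[of "A r"] A C(3) by (auto simp: control_def intro!: less_imp_le)
    qed auto
    moreover have "integral {s..s+h} (\<lambda>r. a \<bullet> A r) = a \<bullet> integral {s..s+h} A"
      using integral_linear[OF i bounded_linear_inner_right[of a]] by (simp add: o_def)
    ultimately have "h * b \<le> a \<bullet> integral {s..s+h} A" using h by simp
    with ab(1) h show False by (simp add: field_simps)
  qed
qed

text \<open>An Euler step with the mean operator. Replacing \<open>x r\<close> by \<open>x s\<close>
  under the integral costs \<open>M\<close> times a displacement of at most
  \<open>M * R * h\<close>, over a length \<open>h\<close>. The estimates below use the equation in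
  this form.\<close>

lemma solves_on_step:
  assumes A: "control \<B> A" and x: "solves_on T A x" and R: "\<And>s. s \<in> {0..T} \<Longrightarrow> norm (x s) \<le> R"
    and C: "closed C" "convex C" "\<B> \<subseteq> C" and sh: "0 \<le> s" "0 < h" "s + h \<le> T"
  shows "\<exists>Y\<in>C. norm (x (s + h) - x s - h *\<^sub>R (Y *v x s)) \<le> M\<^sup>2 * R * h\<^sup>2"
proof -
  define Y where "Y = (1 / h) *\<^sub>R integral {s..s+h} A"
  have iA: "A integrable_on {s..s+h}" and Y: "Y \<in> C"
    using control_average[OF A C sh(2), of s] by (auto simp: Y_def)
  have "continuous_on {s..s+h} x"
    using solves_on_continuous[OF x] sh by simp
  then have i: "(\<lambda>r. A r *v x r) integrable_on {s..s+h}"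
    using control_integrable[OF A] by (auto simp: absolutely_integrable_on_def)
  have bl: "bounded_linear (\<lambda>A. A *v x s)"
    by (rule bounded_bilinear.bounded_linear_left[OF bounded_bilinear_matrix_vector_mult])
  have i2: "(\<lambda>r. A r *v x s) integrable_on {s..s+h}"
    using integrable_linear[OF iA bl] by (simp add: o_def)
  have "h *\<^sub>R (Y *v x s) = integral {s..s+h} A *v x s"
    using sh by (simp add: Y_def scaleR_matrix_vector_assoc)
  also have "\<dots> = integral {s..s+h} (\<lambda>r. A r *v x s)"
    using integral_linear[OF iA bl] by (simp add: o_def)
  finally have "x (s + h) - x s - h *\<^sub>R (Y *v x s) = integral {s..s+h} (\<lambda>r. A r *v x r - A r *v x s)"
    using solves_on_increment[OF A x, of s "s + h"] sh i i2
    by (simp add: Henstock_Kurzweil_Integration.integral_diff)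
  also have "norm \<dots> \<le> integral {s..s+h} (\<lambda>r. M * (M * R * h))"
  proof (rule integral_norm_bound_integral)
    fix r assume r: "r \<in> {s..s+h}"
    have R0: "0 \<le> R" using R[of s] sh norm_ge_zero[of "x s"] by (smt (verit) atLeastAtMost_iff)
    have "norm (A r *v x r - A r *v x s) = norm (A r *v (x r - x s))"
      by (simp add: matrix_vector_mult_diff_distrib)
    also have "\<dots> \<le> M * norm (x r - x s)" by (rule M_control[OF A])
    also have "\<dots> \<le> M * (M * R * (r - s))"
      using solves_on_lipschitz[OF A x R, of s r] r sh M_nonneg by (intro mult_left_mono) auto
    also have "\<dots> \<le> M * (M * R * h)" using r M_nonneg R0 by (intro mult_left_mono) auto
    finally show "norm (A r *v x r - A r *v x s) \<le> M * (M * R * h)" .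
  qed (intro integrable_diff i i2, auto)
  also have "\<dots> = M\<^sup>2 * R * h\<^sup>2" using sh by (simp add: power2_eq_square)
  finally show ?thesis using Y by blast
qed

lemma solves_on_bounded: "solves_on T A x \<Longrightarrow> \<exists>R\<ge>0. \<forall>s\<in>{0..T}. norm (x s) \<le> R"
proof -
  assume "solves_on T A x"
  then have "compact (x ` {0..T})" by (intro compact_continuous_image solves_on_continuous) auto
  then obtain R where "\<forall>s\<in>{0..T}. norm (x s) \<le> R"
    using compact_imp_bounded[of "x ` {0..T}"] unfolding bounded_iff by blast
  then show ?thesis by (intro exI[of _ "max 0 R"]) auto
qed

lemma solves_on_change:
  assumes A: "control \<B> A" and x: "solves_on T A x" and R: "\<And>s. s \<in> {0..T} \<Longrightarrow> norm (x s) \<le> R"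
    and sh: "0 \<le> s" "0 < h" "s + h \<le> T"
  shows "norm (x (s + h) - x s) \<le> h * M * norm (x s) + M\<^sup>2 * R * h\<^sup>2"
proof -
  define C where "C = {Y::real^'d^'d. \<forall>v. norm (Y *v v) \<le> M * norm v}"
  have Ceq: "C = (\<Inter>v. {Y. norm (Y *v v) \<le> M * norm v})" by (auto simp: C_def)
  have cont: "continuous_on UNIV (\<lambda>Y::real^'d^'d. Y *v v)" for v
    by (intro bounded_bilinear.continuous_on[OF bounded_bilinear_matrix_vector_mult] continuous_intros)
  have "closed C" unfolding Ceq
    by (intro closed_INT ballI closed_Collect_le continuous_intros cont)
  moreover have "convex C" unfolding Ceq by (intro convex_INT ballI convex_norm_mult_vec_le)
  moreover have "\<B> \<subseteq> C" using M_bound by (auto simp: C_def)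
  ultimately obtain Y where Y: "Y \<in> C" "norm (x (s + h) - x s - h *\<^sub>R (Y *v x s)) \<le> M\<^sup>2 * R * h\<^sup>2"
    using solves_on_step[OF A x R _ _ _ sh] by blast
  have "norm (x (s + h) - x s) \<le> norm (h *\<^sub>R (Y *v x s)) + norm (x (s + h) - x s - h *\<^sub>R (Y *v x s))"
    by (rule norm_triangle_sub)
  also have "norm (h *\<^sub>R (Y *v x s)) \<le> h * M * norm (x s)"
    using Y(1) sh by (simp add: C_def mult.assoc)
  finally show ?thesis using Y(2) by simp
qed

lemma solves_on_norm_le:
  assumes A: "control \<B> A" and x: "solves_on T A x" and T: "0 \<le> T"
  shows "norm (x T) \<le> exp (M * T) * norm (x 0)"
proof -
  obtain R where R: "R \<ge> 0" "\<And>s. s \<in> {0..T} \<Longrightarrow> norm (x s) \<le> R" using solves_on_bounded[OF x] by blast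
  show ?thesis
  proof (rule exp_bound_of_quadratic_steps[where C = "M\<^sup>2 * R"])
    fix s h assume sh: "0 \<le> s" "0 < h" "s + h \<le> T"
    have "norm (x (s + h)) \<le> norm (x s) + norm (x (s + h) - x s)" by (rule norm_triangle_sub)
    also have "\<dots> \<le> (1 + M * h) * norm (x s) + M\<^sup>2 * R * h\<^sup>2"
      using solves_on_change[OF A x R(2) sh] by (simp add: algebra_simps)
    also have "(1 + M * h) * norm (x s) \<le> exp (M * h) * norm (x s)"
      by (intro mult_right_mono exp_ge_add_one_self norm_ge_zero)
    finally show "norm (x (s + h)) \<le> exp (M * h) * norm (x s) + M\<^sup>2 * R * h\<^sup>2" by simp
  qed (use R T in auto)
qed

text \<open>\<open>exp_bound_of_quadratic_steps\<close> is applied to \<open>- norm (x t)\<close>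
  with rate \<open>- M\<close>; the inequality \<open>exp (- u) \<le> 1 - u + u\<^sup>2\<close>
  absorbs the gap between the linear loss in one step and the exponential. Trajectories thus stay
  away from zero, which later makes \<open>F t\<close> positive.\<close>

lemma solves_on_norm_ge:
  assumes A: "control \<B> A" and x: "solves_on T A x" and T: "0 \<le> T"
  shows "exp (- M * T) * norm (x 0) \<le> norm (x T)"
proof -
  obtain R where R: "R \<ge> 0" "\<And>s. s \<in> {0..T} \<Longrightarrow> norm (x s) \<le> R" using solves_on_bounded[OF x] by blast
  have "- norm (x T) \<le> exp (- M * T) * - norm (x 0)"
  proof (rule exp_bound_of_quadratic_steps[where C = "2 * M\<^sup>2 * R"])
    fix s h assume sh: "0 \<le> s" "0 < h" "s + h \<le> T"
    define u where "u = M * h"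
    have u: "0 \<le> u" using sh M_nonneg by (simp add: u_def)
    have "exp (- u) \<le> 1 - u + u\<^sup>2"
    proof -
      have "1 \<le> 1 + u ^ 3" using u by simp
      also have "\<dots> = (1 + u) * (1 - u + u\<^sup>2)" by (simp add: algebra_simps power2_eq_square power3_eq_cube)
      also have "\<dots> \<le> exp u * (1 - u + u\<^sup>2)"
      proof (rule mult_right_mono)
        have "0 \<le> (1 - u / 2)\<^sup>2 + 3 / 4 * u\<^sup>2" by simp
        then show "0 \<le> 1 - u + u\<^sup>2" by (simp add: power2_eq_square algebra_simps)
      qed simp
      finally show ?thesis by (simp add: exp_minus field_simps)
    qed
    then have "exp (- u) * norm (x s) \<le> (1 - u + u\<^sup>2) * norm (x s)" by (intro mult_right_mono) auto
    moreover have "u\<^sup>2 * norm (x s) \<le> u\<^sup>2 * R" using R(2)[of s] sh by (intro mult_left_mono) auto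
    moreover have "norm (x s) - norm (x (s + h)) \<le> u * norm (x s) + M\<^sup>2 * R * h\<^sup>2"
      using solves_on_change[OF A x R(2) sh] norm_triangle_ineq2[of "x s" "x (s + h)"]
      by (simp add: u_def norm_minus_commute mult_ac)
    ultimately show "- norm (x (s + h)) \<le> exp (- M * h) * - norm (x s) + 2 * M\<^sup>2 * R * h\<^sup>2"
      by (simp add: u_def algebra_simps power_mult_distrib)
  qed (use R T in auto)
  then show ?thesis by simp
qed

lemma solves_on_subset: "solves_on T A x \<Longrightarrow> S \<le> T \<Longrightarrow> solves_on S A x"
  unfolding solves_on_def[of S] using solves_on_continuous[of T A x 0 S] solves_on_eq[of T A x]
  by (meson atLeastAtMost_iff order_refl order_trans)

lemma solves_on_lincomb:
  assumes A: "control \<B> A" and x: "solves_on T A x" and y: "solves_on T A y"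
  shows "solves_on T A (\<lambda>t. a *\<^sub>R x t + b *\<^sub>R y t)"
  unfolding solves_on_def
proof (intro conjI ballI)
  show "continuous_on {0..T} (\<lambda>t. a *\<^sub>R x t + b *\<^sub>R y t)"
    using solves_on_continuous[OF x] solves_on_continuous[OF y] by (auto intro!: continuous_intros)
  fix t assume t: "t \<in> {0..T}"
  have "continuous_on {0..t} x" "continuous_on {0..t} y"
    using solves_on_continuous[OF x] solves_on_continuous[OF y] t by simp_all
  then have i: "(\<lambda>r. A r *v x r) integrable_on {0..t}" "(\<lambda>r. A r *v y r) integrable_on {0..t}"
    using control_integrable[OF A] by (auto simp: absolutely_integrable_on_def)
  have "integral {0..t} (\<lambda>s. A s *v (a *\<^sub>R x s + b *\<^sub>R y s))
      = integral {0..t} (\<lambda>s. a *\<^sub>R (A s *v x s) + b *\<^sub>R (A s *v y s))"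
    by (simp add: matrix_vector_right_distrib matrix_vector_mult_scaleR)
  also have "\<dots> = integral {0..t} (\<lambda>s. a *\<^sub>R (A s *v x s)) + integral {0..t} (\<lambda>s. b *\<^sub>R (A s *v y s))"
    by (intro Henstock_Kurzweil_Integration.integral_add integrable_cmul i)
  finally show "a *\<^sub>R x t + b *\<^sub>R y t =
      a *\<^sub>R x 0 + b *\<^sub>R y 0 + integral {0..t} (\<lambda>s. A s *v (a *\<^sub>R x s + b *\<^sub>R y s))"
    using solves_on_eq[OF x, of t] solves_on_eq[OF y, of t] t
    by (simp add: scaleR_add_right)
qed

text \<open>The value at the right endpoint is left free because one point is negligible; this lets
  controls be glued along half-open intervals.\<close>

lemma solves_on_cong:
  assumes "solves_on T A x" and "\<And>s. s \<in> {0..<T} \<Longrightarrow> A s = B s"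
  shows "solves_on T B x"
  unfolding solves_on_def
proof (intro conjI ballI)
  fix t assume t: "t \<in> {0..T}"
  have "integral {0..t} (\<lambda>s. A s *v x s) = integral {0..t} (\<lambda>s. B s *v x s)"
  proof (rule integral_spike[of "{T}"])
    fix s assume "s \<in> {0..t} - {T}"
    then show "B s *v x s = A s *v x s" using assms(2)[of s] t by auto
  qed auto
  then show "x t = x 0 + integral {0..t} (\<lambda>s. B s *v x s)" using solves_on_eq[OF assms(1), of t] t by simp
qed (use solves_on_continuous[OF assms(1), of 0 T] in simp)

section \<open>Uniqueness and global existence of solutions\<close>

lemma solves_on_unique:
  assumes A: "control \<B> A" and x: "solves_on T A x" and y: "solves_on T A y"
    and "x 0 = y 0" and t: "t \<in> {0..T}"
  shows "x t = y t"
proof -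
  have "solves_on t A (\<lambda>t. 1 *\<^sub>R x t + (-1) *\<^sub>R y t)"
    by (rule solves_on_subset[OF solves_on_lincomb[OF A x y]]) (use t in simp)
  from solves_on_norm_le[OF A this] show ?thesis using t assms(4) by auto
qed

lemma ode_solution_iff_solves_on:
  assumes A: "control \<B> A"
  shows "ode_solution A x \<longleftrightarrow> (\<forall>T. solves_on T A x)"
proof
  assume x: "ode_solution A x"
  show "\<forall>T. solves_on T A x"
  proof (intro allI, cases)
    fix T :: real assume T: "0 \<le> T"
    then have "(\<lambda>s. A s *v x s) integrable_on {0..T}"
      using x unfolding ode_solution_def absolutely_integrable_on_def by blast
    then have c: "continuous_on {0..T} (\<lambda>t. x 0 + integral {0..t} (\<lambda>s. A s *v x s))"
      by (intro continuous_intros indefinite_integral_continuous_1)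
    have eq: "x t = x 0 + integral {0..t} (\<lambda>s. A s *v x s)" if "t \<in> {0..T}" for t
      using x that unfolding ode_solution_def atLeastAtMost_iff by blast
    have "continuous_on {0..T} x"
      by (rule continuous_on_eq[OF c]) (rule eq[symmetric])
    then show "solves_on T A x" unfolding solves_on_def by (intro conjI ballI eq)
  next
    fix T :: real assume "\<not> 0 \<le> T"
    then show "solves_on T A x" by (simp add: solves_on_def)
  qed
next
  assume *: "\<forall>T. solves_on T A x"
  show "ode_solution A x" unfolding ode_solution_def
  proof (intro allI impI conjI)
    fix t :: real assume t: "0 \<le> t"
    note x = *[rule_format, of t]
    show "(\<lambda>s. A s *v x s) absolutely_integrable_on {0..t}"
      by (rule control_integrable[OF A solves_on_continuous[OF x]]) auto
    show "x t = x 0 + integral {0..t} (\<lambda>s. A s *v x s)"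
      by (rule solves_on_eq[OF x]) (use t in auto)
  qed
qed

text \<open>Picard iteration. The differences \<open>D n\<close> of successive iterates obey the
  homogeneous recursion and are bounded by the terms of an exponential series, so the iterates
  converge uniformly on every bounded interval, however long.\<close>

lemma ode_solution_exists:
  assumes A: "control \<B> A"
  shows "\<exists>x. ode_solution A x \<and> x 0 = v"
proof -
  define P where "P = rec_nat (\<lambda>_. v) (\<lambda>_ p t. v + integral {0..t} (\<lambda>s. A s *v p s))"
  have P0: "P 0 t = v" and PSuc: "P (Suc n) t = v + integral {0..t} (\<lambda>s. A s *v P n s)" for n t
    by (simp_all add: P_def)
  have Pcont: "continuous_on {0..T} (P n)" for n and T :: real
  proof (induction n)
    case 0
    then show ?case by (simp add: P_def)
  next
    case (Suc n)
    have "P (Suc n) = (\<lambda>t. v + integral {0..t} (\<lambda>s. A s *v P n s))" by (auto simp: PSuc)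
    moreover have "(\<lambda>s. A s *v P n s) integrable_on {0..T}"
      using control_integrable[OF A Suc] by (auto simp: absolutely_integrable_on_def)
    ultimately show ?case by (simp add: indefinite_integral_continuous_1 continuous_on_add)
  qed
  have Pint: "(\<lambda>s. A s *v P n s) integrable_on {0..T}" for n and T :: real
    using control_integrable[OF A Pcont] by (auto simp: absolutely_integrable_on_def)
  define D where "D n t = P (Suc n) t - P n t" for n t
  have DSuc: "D (Suc n) t = integral {0..t} (\<lambda>s. A s *v D n s)" for n t
    unfolding D_def PSuc[of "Suc n"] PSuc[of n t]
    by (simp add: Henstock_Kurzweil_Integration.integral_diff[OF Pint Pint, symmetric] matrix_vector_mult_diff_distrib)
  have Dint: "(\<lambda>s. A s *v D n s) integrable_on {0..T}" for n and T :: real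
    unfolding D_def matrix_vector_mult_diff_distrib by (intro integrable_diff Pint)
  have Dbound: "norm (D n t) \<le> norm v * M ^ Suc n * t ^ Suc n / fact (Suc n)" if "0 \<le> t" for n t
    using that
  proof (induction n arbitrary: t)
    case 0
    have "norm (integral {0..t} (\<lambda>s. A s *v P 0 s)) \<le> integral {0..t} (\<lambda>s. M * norm v)"
      by (intro integral_norm_bound_integral Pint) (auto simp: P0 M_control[OF A])
    then show ?case using 0 by (simp add: D_def PSuc[of 0] P0 mult_ac)
  next
    case (Suc n)
    have "((\<lambda>s. M * (norm v * M ^ Suc n * s ^ Suc n / fact (Suc n))) has_integral
        norm v * M ^ Suc (Suc n) * t ^ Suc (Suc n) / fact (Suc (Suc n))
          - norm v * M ^ Suc (Suc n) * 0 ^ Suc (Suc n) / fact (Suc (Suc n))) {0..t}"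
    proof (rule fundamental_theorem_of_calculus[OF Suc.prems])
      fix s
      have f: "fact (Suc (Suc n)) = (real (Suc (Suc n))) * fact (Suc n)" by (simp only: fact_Suc)
      have "((\<lambda>s. norm v * M ^ Suc (Suc n) * s ^ Suc (Suc n) / fact (Suc (Suc n))) has_real_derivative
          norm v * M ^ Suc (Suc n) * (real (Suc (Suc n)) * s ^ Suc n) / fact (Suc (Suc n))) (at s within {0..t})"
        by (rule derivative_eq_intros refl | simp)+
      also have "norm v * M ^ Suc (Suc n) * (real (Suc (Suc n)) * s ^ Suc n) / fact (Suc (Suc n))
          = M * (norm v * M ^ Suc n * s ^ Suc n / fact (Suc n))"
        unfolding f by (simp del: of_nat_Suc fact_Suc)
      finally show "((\<lambda>s. norm v * M ^ Suc (Suc n) * s ^ Suc (Suc n) / fact (Suc (Suc n))) has_vector_derivative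
          M * (norm v * M ^ Suc n * s ^ Suc n / fact (Suc n))) (at s within {0..t})"
        by (simp add: has_real_derivative_iff_has_vector_derivative)
    qed
    then have I: "((\<lambda>s. M * (norm v * M ^ Suc n * s ^ Suc n / fact (Suc n))) has_integral
        norm v * M ^ Suc (Suc n) * t ^ Suc (Suc n) / fact (Suc (Suc n))) {0..t}" by simp
    have "norm (D (Suc n) t) \<le> integral {0..t} (\<lambda>s. M * (norm v * M ^ Suc n * s ^ Suc n / fact (Suc n)))"
      unfolding DSuc
    proof (intro integral_norm_bound_integral Dint)
      show "(\<lambda>s. M * (norm v * M ^ Suc n * s ^ Suc n / fact (Suc n))) integrable_on {0..t}"
        using I by blast
      fix s assume "s \<in> {0..t}"
      then show "norm (A s *v D n s) \<le> M * (norm v * M ^ Suc n * s ^ Suc n / fact (Suc n))"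
        using M_control[OF A, of s "D n s"] Suc.IH[of s] M_nonneg
        by (meson atLeastAtMost_iff mult_left_mono order_trans)
    qed
    also have "\<dots> = norm v * M ^ Suc (Suc n) * t ^ Suc (Suc n) / fact (Suc (Suc n))"
      using I by (rule integral_unique)
    finally show ?case .
  qed
  define x where "x t = v + (\<Sum>n. D n t)" for t
  have Psum: "P n t = v + (\<Sum>i<n. D i t)" for n t
    using sum_lessThan_telescope[of "\<lambda>i. P i t" n] by (simp add: D_def P0)
  have ul: "uniform_limit {0..T} P x sequentially" if T: "0 \<le> T" for T
  proof -
    have "summable (\<lambda>n. norm v * (inverse (fact (Suc n)) * (M * T) ^ Suc n))"
      by (intro summable_mult summable_Suc_iff[THEN iffD2, OF summable_exp[of "M * T"]])
    then have "uniform_limit {0..T} (\<lambda>n t. \<Sum>i<n. D i t) (\<lambda>t. suminf (\<lambda>i. D i t)) sequentially"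
    proof (rule Weierstrass_m_test[rotated])
      fix n t assume t: "t \<in> {0..T}"
      have "norm (D n t) \<le> norm v * M ^ Suc n * t ^ Suc n / fact (Suc n)" using Dbound t by simp
      also have "\<dots> \<le> norm v * M ^ Suc n * T ^ Suc n / fact (Suc n)"
        using t M_nonneg by (intro divide_right_mono mult_left_mono power_mono) auto
      finally show "norm (D n t) \<le> norm v * (inverse (fact (Suc n)) * (M * T) ^ Suc n)"
        by (simp add: power_mult_distrib field_simps del: fact_Suc)
    qed
    then have "uniform_limit {0..T} (\<lambda>n t. v + (\<Sum>i<n. D i t)) (\<lambda>t. v + suminf (\<lambda>i. D i t)) sequentially"
      by (intro uniform_limit_intros)
    then show ?thesis using Psum x_def by presburger
  qed
  have x0: "x 0 = v"
  proof -
    have "P n 0 = v" for n by (cases n) (auto simp: P0 PSuc)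
    then have "(\<lambda>n. P n 0) \<longlonglongrightarrow> v" by simp
    moreover have "(\<lambda>n. P n 0) \<longlonglongrightarrow> x 0"
      using tendsto_uniform_limitI[OF ul[of 0], of 0] by simp
    ultimately show ?thesis using LIMSEQ_unique by blast
  qed
  have "solves_on T A x" if T: "0 \<le> T" for T
    unfolding solves_on_def
  proof (intro conjI ballI)
    show xcont: "continuous_on {0..T} x"
      by (rule uniform_limit_theorem[OF _ ul[OF T]]) (auto simp: Pcont)
    fix t assume t: "t \<in> {0..T}"
    have "compact (x ` {0..T})" by (intro compact_continuous_image xcont) auto
    then obtain R where R: "\<And>s. s \<in> {0..T} \<Longrightarrow> norm (x s) \<le> R"
      using compact_imp_bounded[of "x ` {0..T}"] unfolding bounded_iff by blast
    have lim1: "(\<lambda>n. P (Suc n) t) \<longlonglongrightarrow> x t"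
      using tendsto_uniform_limitI[OF ul[OF T] t] by (rule LIMSEQ_Suc)
    have "(\<lambda>n. integral {0..t} (\<lambda>s. A s *v P n s)) \<longlonglongrightarrow> integral {0..t} (\<lambda>s. A s *v x s)"
    proof (rule metric_LIMSEQ_I)
      fix e :: real assume e: "e > 0"
      define \<delta> where "\<delta> = e / ((M + 1) * (T + 1))"
      have \<delta>: "\<delta> > 0" using e T M_nonneg by (simp add: \<delta>_def)
      obtain N where N: "\<And>n s. N \<le> n \<Longrightarrow> s \<in> {0..T} \<Longrightarrow> dist (P n s) (x s) < \<delta>"
        using uniform_limitD[OF ul[OF T] \<delta>] unfolding eventually_sequentially by blast
      have xi: "(\<lambda>s. A s *v x s) integrable_on {0..t}"
        using control_integrable[OF A continuous_on_subset[OF xcont, of "{0..t}"]] t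
        by (simp add: absolutely_integrable_on_def)
      have "dist (integral {0..t} (\<lambda>s. A s *v P n s)) (integral {0..t} (\<lambda>s. A s *v x s)) < e" if n: "N \<le> n" for n
      proof -
        have "norm (integral {0..t} (\<lambda>s. A s *v P n s - A s *v x s)) \<le> integral {0..t} (\<lambda>s. M * \<delta>)"
        proof (intro integral_norm_bound_integral integrable_diff Pint xi)
          fix s assume s: "s \<in> {0..t}"
          have "norm (A s *v P n s - A s *v x s) \<le> M * norm (P n s - x s)"
            using M_control[OF A] by (simp add: matrix_vector_mult_diff_distrib[symmetric])
          also have "\<dots> \<le> M * \<delta>"
            using N[OF n, of s] s t M_nonneg by (intro mult_left_mono) (auto simp: dist_norm less_imp_le)
          finally show "norm (A s *v P n s - A s *v x s) \<le> M * \<delta>" .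
        qed auto
        also have "integral {0..t} (\<lambda>s. M * \<delta>) = M * t * \<delta>" using t by simp
        also have "M * t * \<delta> < (M + 1) * (T + 1) * \<delta>"
          using \<delta> t M_nonneg by (intro mult_strict_right_mono mult_strict_mono') auto
        also have "\<dots> = e" using T M_nonneg by (simp add: \<delta>_def)
        finally show ?thesis
          using Henstock_Kurzweil_Integration.integral_diff[OF Pint xi, of n] by (simp add: dist_norm)
      qed
      then show "\<exists>N. \<forall>n\<ge>N. dist (integral {0..t} (\<lambda>s. A s *v P n s)) (integral {0..t} (\<lambda>s. A s *v x s)) < e"
        by blast
    qed
    then have "(\<lambda>n. P (Suc n) t) \<longlonglongrightarrow> v + integral {0..t} (\<lambda>s. A s *v x s)"
      unfolding PSuc by (intro tendsto_intros)
    then show "x t = x 0 + integral {0..t} (\<lambda>s. A s *v x s)"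
      unfolding x0 by (rule LIMSEQ_unique[OF lim1])
  qed
  moreover have "solves_on T A x" if "\<not> 0 \<le> T" for T using that by (simp add: solves_on_def)
  ultimately show ?thesis using ode_solution_iff_solves_on[OF A] x0 by blast
qed

end

section \<open>Invariance of the cone\<close>

lemma metzler_iff: "metzler K A \<longleftrightarrow> (\<exists>h>0. \<forall>v\<in>K. v + h *\<^sub>R (A *v v) \<in> K)"
  unfolding metzler_def
  by (auto simp: matrix_vector_mult_add_rdistrib scaleR_matrix_vector_assoc image_subset_iff)

text \<open>The step \<open>h\<close> in the definition of a Metzler operator need not be bounded below on a compact family, so only this estimate, whose constant depends on the norm bound alone, is uniform.\<close>

lemma metzler_second_order:
  fixes K :: "(real^'d) set"
  assumes K: "cone K" "convex K" and A: "metzler K A" and M: "\<And>v. norm (A *v v) \<le> M * norm v" "0 \<le> M"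
    and x: "x \<in> K" and h: "0 \<le> h"
  shows "\<exists>z\<in>K. norm (x + h *\<^sub>R (A *v x) - z) \<le> M\<^sup>2 * exp (M * h) * norm x * h\<^sup>2"
proof -
  obtain h0 where h0: "h0 > 0" "\<And>v. v \<in> K \<Longrightarrow> v + h0 *\<^sub>R (A *v v) \<in> K"
    using A unfolding metzler_iff by blast
  obtain n where n: "h / h0 \<le> real (Suc n)" using real_arch_simple
    by (meson le_Suc_eq nat_le_real_less of_nat_le_iff order_trans Suc_leD le_SucI order_refl)
  \<comment> \<open>Steps of length at most \<open>h0\<close> are used, so that each Euler step is a
    convex combination of \<open>v\<close> and \<open>v + h0 *\<^sub>R (A *v v)\<close> and stays in
    the cone. The number of steps depends on \<open>A\<close> but drops out of the final
    bound.\<close>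
  define d where "d = h / real (Suc n)"
  have d: "0 \<le> d" "d \<le> h0" using n h h0(1) by (auto simp: d_def field_simps)
  have hd: "real (Suc n) * d = h" by (simp add: d_def)
  have stepK: "v + d *\<^sub>R (A *v v) \<in> K" if "v \<in> K" for v
  proof -
    have "(1 - d / h0) *\<^sub>R v + (d / h0) *\<^sub>R (v + h0 *\<^sub>R (A *v v)) \<in> K"
      using d h0 that by (intro convexD[OF K(2)]) auto
    also have "(1 - d / h0) *\<^sub>R v + (d / h0) *\<^sub>R (v + h0 *\<^sub>R (A *v v)) = v + d *\<^sub>R (A *v v)"
      using h0 by (simp add: algebra_simps)
    finally show ?thesis .
  qed
  define y where "y = rec_nat x (\<lambda>_ v. v + d *\<^sub>R (A *v v))"
  have y0: "y 0 = x" and ySuc: "y (Suc k) = y k + d *\<^sub>R (A *v y k)" for k by (simp_all add: y_def)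
  have yK: "y k \<in> K" for k by (induction k) (auto simp: y0 ySuc x stepK)
  define E where "E = exp (M * h)"
  have ynorm: "norm (y k) \<le> E * norm x" if "k \<le> Suc n" for k
  proof -
    have "norm (y k) \<le> (1 + M * d) ^ k * norm x"
    proof (induction k)
      case (Suc k)
      have "norm (y (Suc k)) \<le> norm (y k) + d * (M * norm (y k))"
        using norm_triangle_ineq[of "y k" "d *\<^sub>R (A *v y k)"] mult_left_mono[OF M(1)[of "y k"] d(1)] d
        by (simp add: ySuc)
      also have "\<dots> = (1 + M * d) * norm (y k)" by (simp add: algebra_simps)
      also have "\<dots> \<le> (1 + M * d) * ((1 + M * d) ^ k * norm x)"
        using Suc M d by (intro mult_left_mono) auto
      finally show ?case by simp
    qed (simp add: y0)
    also have "(1 + M * d) ^ k \<le> exp (M * d) ^ k"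
      using M d by (intro power_mono) auto
    also have "exp (M * d) ^ k = exp (real k * (M * d))" by (simp add: exp_of_nat_mult)
    also have "\<dots> \<le> E"
    proof -
      have "real k * (M * d) \<le> real (Suc n) * (M * d)" using that M d by (intro mult_right_mono) auto
      also have "\<dots> = M * h" using hd by (simp add: mult_ac)
      finally show ?thesis by (simp add: E_def)
    qed
    finally show ?thesis by (simp add: mult_right_mono)
  qed
  have E: "0 \<le> E" by (simp add: E_def)
  have y1: "norm (y k - x) \<le> real k * d * (M * (E * norm x))" if "k \<le> Suc n" for k
    using that
  proof (induction k)
    case (Suc k)
    have "norm (y (Suc k) - x) \<le> norm (y k - x) + d * norm (A *v y k)"
      using norm_triangle_ineq[of "y k - x" "d *\<^sub>R (A *v y k)"] d by (simp add: ySuc algebra_simps)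
    moreover have "norm (A *v y k) \<le> M * (E * norm x)"
      using M(1)[of "y k"] mult_left_mono[OF ynorm[of k] M(2)] Suc.prems by simp
    then have "d * norm (A *v y k) \<le> d * (M * (E * norm x))" using d by (intro mult_left_mono)
    ultimately show ?case using Suc by (simp add: algebra_simps)
  qed (simp add: y0)
  \<comment> \<open>Each step adds \<open>d\<close> times \<open>A\<close> applied to the drift
    \<open>y k - x\<close>, which by \<open>y1\<close> is at most
    \<open>h * (M * (E * norm x))\<close>. The steps sum to \<open>h\<close>, so the deviation is
    quadratic in \<open>h\<close>.\<close>
  have y2: "norm (y k - x - (real k * d) *\<^sub>R (A *v x)) \<le> real k * d * (M * (h * (M * (E * norm x))))"
    if "k \<le> Suc n" for k
    using that
  proof (induction k)
    case (Suc k)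
    have eq: "y (Suc k) - x - (real (Suc k) * d) *\<^sub>R (A *v x)
        = (y k - x - (real k * d) *\<^sub>R (A *v x)) + d *\<^sub>R (A *v (y k - x))"
      by (simp add: ySuc algebra_simps matrix_vector_mult_diff_distrib)
    have "norm (y (Suc k) - x - (real (Suc k) * d) *\<^sub>R (A *v x))
        \<le> norm (y k - x - (real k * d) *\<^sub>R (A *v x)) + d * norm (A *v (y k - x))"
      unfolding eq using norm_triangle_ineq[of "y k - x - (real k * d) *\<^sub>R (A *v x)" "d *\<^sub>R (A *v (y k - x))"] d by simp
    moreover have "d * norm (A *v (y k - x)) \<le> d * (M * (h * (M * (E * norm x))))"
    proof (rule mult_left_mono[OF _ d(1)])
      have "real k * d \<le> real (Suc n) * d" using Suc.prems d by (intro mult_right_mono) auto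
      then have "real k * d * (M * (E * norm x)) \<le> h * (M * (E * norm x))"
        using hd M E by (intro mult_right_mono) auto
      then have "norm (y k - x) \<le> h * (M * (E * norm x))" using y1[of k] Suc.prems by simp
      then show "norm (A *v (y k - x)) \<le> M * (h * (M * (E * norm x)))"
        using M(1)[of "y k - x"] mult_left_mono[OF _ M(2)] order_trans by blast
    qed
    ultimately show ?case using Suc by (simp add: algebra_simps)
  qed (simp add: y0)
  have "norm (x + h *\<^sub>R (A *v x) - y (Suc n)) = norm (y (Suc n) - x - (real (Suc n) * d) *\<^sub>R (A *v x))"
    unfolding hd by (metis diff_diff_eq norm_minus_commute)
  also have "\<dots> \<le> h * (M * (h * (M * (E * norm x))))"
    using y2[of "Suc n"] unfolding hd by simp
  also have "\<dots> = M\<^sup>2 * exp (M * h) * norm x * h\<^sup>2" by (simp add: E_def power2_eq_square)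
  finally show ?thesis using yK by blast
qed

text \<open>If a step \<open>h\<close> maps the cone into itself, so does every smaller positive
  one. Two operators therefore share an admissible step, which makes the Metzler operators a convex
  set.\<close>

lemma metzler_convex_hull:
  fixes K :: "(real^'d) set"
  assumes K: "convex K" and "\<forall>A\<in>\<A>. metzler K A" and "A \<in> convex hull \<A>"
  shows "metzler K A"
proof -
  have mono: "v + d *\<^sub>R (A *v v) \<in> K" if "\<forall>v\<in>K. v + h *\<^sub>R (A *v v) \<in> K" "0 < d" "d \<le> h" "v \<in> K" for d h A v
  proof -
    have "(1 - d / h) *\<^sub>R v + (d / h) *\<^sub>R (v + h *\<^sub>R (A *v v)) \<in> K"
      using that by (intro convexD[OF K]) auto
    also have "(1 - d / h) *\<^sub>R v + (d / h) *\<^sub>R (v + h *\<^sub>R (A *v v)) = v + d *\<^sub>R (A *v v)"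
      using that by (simp add: algebra_simps)
    finally show ?thesis .
  qed
  have "convex {A. metzler K A}"
  proof (rule convexI, unfold mem_Collect_eq)
    fix A B :: "real^'d^'d" and a b :: real
    assume AB: "metzler K A" "metzler K B" and ab: "0 \<le> a" "0 \<le> b" "a + b = 1"
    from AB obtain g h where g: "g > 0" "\<forall>v\<in>K. v + g *\<^sub>R (A *v v) \<in> K" and
        h: "h > 0" "\<forall>v\<in>K. v + h *\<^sub>R (B *v v) \<in> K" unfolding metzler_iff by blast
    define d where "d = min g h"
    have "v + d *\<^sub>R ((a *\<^sub>R A + b *\<^sub>R B) *v v) \<in> K" if v: "v \<in> K" for v
    proof -
      have "a *\<^sub>R (v + d *\<^sub>R (A *v v)) + b *\<^sub>R (v + d *\<^sub>R (B *v v)) \<in> K"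
        using g h v by (intro convexD[OF K] ab mono[OF g(2)] mono[OF h(2)]) (auto simp: d_def)
      also have "a *\<^sub>R (v + d *\<^sub>R (A *v v)) + b *\<^sub>R (v + d *\<^sub>R (B *v v)) =
          (a + b) *\<^sub>R v + d *\<^sub>R ((a *\<^sub>R A + b *\<^sub>R B) *v v)"
        unfolding matrix_vector_mult_add_rdistrib scaleR_matrix_vector_assoc[symmetric]
        by (simp only: scaleR_add_right scaleR_add_left scaleR_scaleR mult.commute add_ac)
      finally show ?thesis using ab by simp
    qed
    moreover have "d > 0" using g h by (simp add: d_def)
    ultimately show "metzler K (a *\<^sub>R A + b *\<^sub>R B)" unfolding metzler_iff by blast
  qed
  then have "convex hull \<A> \<subseteq> {A. metzler K A}" using assms(2) by (intro hull_minimal) auto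
  then show ?thesis using assms(3) by blast
qed

context bounded_operators begin

text \<open>The distance to the cone obeys a Gronwall inequality and starts at zero. In one step the
  nearest point \<open>z\<close> of the cone is moved by the same mean operator \<open>Y\<close>; by
  the second-order estimate it ends close to a point of the cone, while the gap grows by at most the
  factor \<open>1 + M * h\<close>. Since \<open>0\<close> lies in the cone,
  \<open>norm z \<le> 2 * R\<close>, which makes the error constant uniform.\<close>

lemma solves_on_in_cone:
  assumes A: "control \<B> A" and x: "solves_on T A x" and T: "0 \<le> T"
    and K: "cone K" "convex K" "closed K" "K \<noteq> {}" and B: "compact \<B>" "\<forall>A\<in>\<B>. metzler K A" and x0: "x 0 \<in> K"
  shows "x T \<in> K"
proof -
  obtain R where R: "R \<ge> 0" "\<And>s. s \<in> {0..T} \<Longrightarrow> norm (x s) \<le> R" using solves_on_bounded[OF x] by blast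
  define C where "C = M\<^sup>2 * R + M\<^sup>2 * exp (M * T) * (2 * R)"
  have zK: "0 \<in> K" using K by (simp add: cone_contains_0)
  have CM: "norm (Y *v v) \<le> M * norm v" if "Y \<in> convex hull \<B>" for Y v
    using bounded_operators.M_bound[OF bounded_operators_convex_hull that] .
  have "infdist (x T) K \<le> exp (M * T) * infdist (x 0) K"
  proof (rule exp_bound_of_quadratic_steps[where C = C])
    fix s h assume sh: "0 \<le> s" "0 < h" "s + h \<le> T"
    obtain Y where Y: "Y \<in> convex hull \<B>" "norm (x (s + h) - x s - h *\<^sub>R (Y *v x s)) \<le> M\<^sup>2 * R * h\<^sup>2"
      using solves_on_step[OF A x R(2) _ _ _ sh, of "convex hull \<B>"] B(1)
      by (meson compact_convex_hull compact_imp_closed convex_convex_hull hull_subset)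
    obtain z where z: "z \<in> K" "infdist (x s) K = dist (x s) z" using infdist_attains_inf K by metis
    have Rs: "norm (x s) \<le> R" using R(2) sh by simp
    have "dist (x s) z \<le> dist (x s) 0" using z(2) infdist_le[OF zK] by metis
    then have zR: "norm z \<le> 2 * R" using norm_triangle_ineq3[of z "x s"] norm_triangle_sub[of z "x s"] Rs
      by (simp add: dist_norm norm_minus_commute)
    obtain w where w: "w \<in> K" "norm (z + h *\<^sub>R (Y *v z) - w) \<le> M\<^sup>2 * exp (M * h) * norm z * h\<^sup>2"
      using metzler_second_order[OF K(1,2) metzler_convex_hull[OF K(2) B(2) Y(1)] CM[OF Y(1)] M_nonneg z(1), of h] sh by auto
    have w2: "norm (z + h *\<^sub>R (Y *v z) - w) \<le> M\<^sup>2 * exp (M * T) * (2 * R) * h\<^sup>2"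
      by (rule order_trans[OF w(2)])
        (use M_nonneg sh zR in \<open>intro mult_right_mono mult_mono; simp add: mult_left_mono\<close>)
    have "infdist (x (s + h)) K \<le> norm (x (s + h) - w)" using infdist_le[OF w(1)] by (simp add: dist_norm)
    also have "x (s + h) - w = (x (s + h) - x s - h *\<^sub>R (Y *v x s)) + (x s - z) + h *\<^sub>R (Y *v (x s - z)) + (z + h *\<^sub>R (Y *v z) - w)"
      by (simp add: algebra_simps matrix_vector_mult_diff_distrib)
    also have "norm \<dots> \<le> norm (x (s + h) - x s - h *\<^sub>R (Y *v x s)) + norm (x s - z) + norm (h *\<^sub>R (Y *v (x s - z))) + norm (z + h *\<^sub>R (Y *v z) - w)"
      by (intro norm_triangle_mono order_refl)
    also have "\<dots> \<le> M\<^sup>2 * R * h\<^sup>2 + norm (x s - z) + h * (M * norm (x s - z)) + M\<^sup>2 * exp (M * T) * (2 * R) * h\<^sup>2"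
      using Y(2) w2 CM[OF Y(1)] sh by (intro add_mono) (auto intro: mult_left_mono)
    also have "\<dots> = (1 + M * h) * infdist (x s) K + C * h\<^sup>2"
      using z(2) by (simp add: C_def dist_norm algebra_simps)
    also have "(1 + M * h) * infdist (x s) K \<le> exp (M * h) * infdist (x s) K"
      by (intro mult_right_mono exp_ge_add_one_self infdist_nonneg)
    finally show "infdist (x (s + h)) K \<le> exp (M * h) * infdist (x s) K + C * h\<^sup>2" by simp
  qed (use R T in \<open>auto simp: C_def\<close>)
  then have "infdist (x T) K \<le> 0" using x0 by simp
  then have "infdist (x T) K = 0" using infdist_nonneg[of "x T" K] by linarith
  then show ?thesis using K in_closed_iff_infdist_zero by blast
qed

end

section \<open>Flows and their concatenation\<close>

lemma lebesgue_measurable_translation: "(+) (a::real) \<in> lebesgue \<rightarrow>\<^sub>M lebesgue"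
  using lebesgue_affine_measurable[of "\<lambda>_. 1" a] by simp

lemma control_shift: "control \<B> A \<Longrightarrow> control \<B> (\<lambda>s. A (a + s))"
  using measurable_compose[OF lebesgue_measurable_translation, of A borel a]
  by (auto simp: control_def)

text \<open>Block \<open>k\<close> of length \<open>T\<close> uses \<open>A k\<close> with its clock
  restarted; \<open>nat\<close> puts negative times into block 0. Measurability holds because the
  blocks are countably many.\<close>

lemma control_concat:
  assumes A: "\<And>k. control \<B> (A k)"
  shows "control \<B> (\<lambda>s. A (nat \<lfloor>s / T\<rfloor>) (- (real (nat \<lfloor>s / T\<rfloor>) * T) + s))"
proof -
  have g: "(\<lambda>s. nat \<lfloor>s / T\<rfloor>) \<in> measurable lebesgue (count_space UNIV)"
    by (rule measurable_completion) measurable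
  have "(\<lambda>s. A k (- (real k * T) + s)) \<in> borel_measurable lebesgue" for k
    using control_shift[OF A[of k], of "- (real k * T)"] by (simp add: control_def)
  from measurable_compose_countable[OF this g]
  have "(\<lambda>s. A (nat \<lfloor>s / T\<rfloor>) (- (real (nat \<lfloor>s / T\<rfloor>) * T) + s)) \<in> borel_measurable lebesgue" .
  moreover have "range (A k) \<subseteq> \<B>" for k using A[of k] by (simp add: control_def)
  ultimately show ?thesis unfolding control_def by blast
qed

lemma control_append:
  assumes "control \<B> A" "control \<B> B"
  shows "control \<B> (\<lambda>r. if r < s then A r else B (- s + r))"
proof -
  have "{..<s} \<in> sets lebesgue" by simp
  then have "(\<lambda>r. if r < s then A r else B (- s + r)) \<in> borel_measurable lebesgue"
    using assms(1) control_shift[OF assms(2), of "- s"] unfolding control_def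
    by (intro measurable_If) auto
  then show ?thesis using assms by (auto simp: control_def)
qed

text \<open>The values of a solution at negative times are arbitrary.\<close>

definition flow :: "(real \<Rightarrow> real^'d^'d) \<Rightarrow> real^'d \<Rightarrow> real \<Rightarrow> real^'d" where
  "flow A v = (SOME x. ode_solution A x \<and> x 0 = v)"

definition flow_maps :: "(real^'d^'d) set \<Rightarrow> real \<Rightarrow> (real^'d \<Rightarrow> real^'d) set" where
  "flow_maps \<B> t = {\<lambda>v. flow A v t | A. control \<B> A}"

context bounded_operators begin

lemma flow:
  assumes "control \<B> A"
  shows flow_solution: "ode_solution A (flow A v)" and flow_0: "flow A v 0 = v"
  using someI_ex[OF ode_solution_exists[OF assms, of v]] by (auto simp: flow_def)

lemma flow_solves_on: "control \<B> A \<Longrightarrow> solves_on T A (flow A v)"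
  using ode_solution_iff_solves_on flow_solution by blast

lemma solves_on_eq_flow:
  assumes "control \<B> A" "solves_on T A x" "0 \<le> t" "t \<le> T"
  shows "x t = flow A (x 0) t"
  by (rule solves_on_unique[OF assms(1,2) flow_solves_on[OF assms(1)]]) (use assms in \<open>auto simp: flow_0\<close>)

lemma ode_solution_eq_flow:
  assumes "control \<B> A" "ode_solution A x" "0 \<le> t"
  shows "x t = flow A (x 0) t"
  using solves_on_eq_flow[OF assms(1) _ assms(3) order_refl] ode_solution_iff_solves_on assms by blast

lemma flow_lincomb:
  assumes A: "control \<B> A" and t: "0 \<le> t"
  shows "flow A (a *\<^sub>R u + b *\<^sub>R v) t = a *\<^sub>R flow A u t + b *\<^sub>R flow A v t"
  using solves_on_eq_flow[OF A solves_on_lincomb[OF A flow_solves_on[OF A] flow_solves_on[OF A]] t order_refl, of a u b v]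
  by (simp add: flow_0[OF A])

lemma linear_flow:
  assumes "control \<B> A" "0 \<le> t"
  shows "linear (\<lambda>v. flow A v t)"
proof (rule linearI)
  show "flow A (u + v) t = flow A u t + flow A v t" for u v
    using flow_lincomb[OF assms, of 1 u 1 v] by simp
  show "flow A (c *\<^sub>R v) t = c *\<^sub>R flow A v t" for c v
    using flow_lincomb[OF assms, of c v 0 v] by simp
qed

lemma flow_norm_le: "control \<B> A \<Longrightarrow> 0 \<le> t \<Longrightarrow> norm (flow A v t) \<le> exp (M * t) * norm v"
  using solves_on_norm_le[OF _ flow_solves_on, of A t v] by (simp add: flow_0)

lemma flow_norm_ge: "control \<B> A \<Longrightarrow> 0 \<le> t \<Longrightarrow> exp (- M * t) * norm v \<le> norm (flow A v t)"
  using solves_on_norm_ge[OF _ flow_solves_on, of A t v] by (simp add: flow_0)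

lemma flow_cong:
  assumes "control \<B> A" "control \<B> B" "\<And>s. s \<in> {0..<t} \<Longrightarrow> A s = B s" "0 \<le> t"
  shows "flow A v t = flow B v t"
  using solves_on_eq_flow[OF assms(2) solves_on_cong[OF flow_solves_on[OF assms(1)] assms(3)] assms(4) order_refl]
  by (simp add: flow_0[OF assms(1)])

lemma ode_solution_shift:
  assumes A: "control \<B> A" and x: "ode_solution A x" and a: "0 \<le> a"
  shows "ode_solution (\<lambda>s. A (a + s)) (\<lambda>s. x (a + s))"
  unfolding ode_solution_iff_solves_on[OF control_shift[OF A]]
proof
  fix T :: real
  show "solves_on T (\<lambda>s. A (a + s)) (\<lambda>s. x (a + s))"
    unfolding solves_on_def
  proof (intro conjI ballI)
    have s: "solves_on (a + t) A x" for t using x ode_solution_iff_solves_on[OF A] by blast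
    show "continuous_on {0..T} (\<lambda>s. x (a + s))"
      by (rule continuous_on_compose2[OF solves_on_continuous[OF s[of T], of 0 "a + T"]])
        (use a in \<open>auto intro!: continuous_intros\<close>)
    fix t assume t: "t \<in> {0..T}"
    have "x (a + t) - x a = integral {a..a+t} (\<lambda>r. A r *v x r)"
      using solves_on_increment[OF A s[of t], of a "a + t"] t a by simp
    also have "\<dots> = integral {0..t} (\<lambda>s. A (a + s) *v x (a + s))"
      using integral_shift_Icc_real[of 0 t "\<lambda>r. A r *v x r" a] by (simp add: o_def add.commute)
    finally show "x (a + t) = x (a + 0) + integral {0..t} (\<lambda>s. A (a + s) *v x (a + s))"
      by (simp add: algebra_simps)
  qed
qed

lemma flow_shift:
  assumes "control \<B> A" "0 \<le> s" "0 \<le> t"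
  shows "flow A v (s + t) = flow (\<lambda>r. A (s + r)) (flow A v s) t"
  using ode_solution_eq_flow[OF control_shift[OF assms(1)] ode_solution_shift[OF assms(1) flow_solution[OF assms(1)] assms(2)] assms(3)]
  by simp

lemma flow_append:
  assumes "control \<B> A" "control \<B> B" "0 \<le> s" "0 \<le> t"
  shows "flow (\<lambda>r. if r < s then A r else B (- s + r)) v (s + t) = flow B (flow A v s) t"
proof -
  note C = control_append[OF assms(1,2), of s]
  have "flow (\<lambda>r. if r < s then A r else B (- s + r)) v s = flow A v s"
    by (rule flow_cong[OF C assms(1) _ assms(3)]) auto
  moreover have "flow (\<lambda>r. if s + r < s then A (s + r) else B (- s + (s + r))) w t = flow B w t" for w
    by (rule flow_cong[OF control_shift[OF C, of s] assms(2) _ assms(4)]) auto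
  ultimately show ?thesis using flow_shift[OF C assms(3,4), of v] by simp
qed

lemma flow_maps_comp:
  assumes "\<Phi> \<in> flow_maps \<B> s" "\<Psi> \<in> flow_maps \<B> t" "0 \<le> s" "0 \<le> t"
  shows "\<Psi> \<circ> \<Phi> \<in> flow_maps \<B> (s + t)"
proof -
  obtain A B where A: "control \<B> A" "\<Phi> = (\<lambda>v. flow A v s)" and B: "control \<B> B" "\<Psi> = (\<lambda>v. flow B v t)"
    using assms by (auto simp: flow_maps_def)
  have "\<Psi> \<circ> \<Phi> = (\<lambda>v. flow (\<lambda>r. if r < s then A r else B (- s + r)) v (s + t))"
    using flow_append[OF A(1) B(1) assms(3,4)] by (simp add: A(2) B(2) o_def)
  then show ?thesis using control_append[OF A(1) B(1), of s] unfolding flow_maps_def by blast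
qed

lemma flow_maps_split:
  assumes "\<Phi> \<in> flow_maps \<B> (s + t)" "0 \<le> s" "0 \<le> t"
  shows "\<exists>\<Phi>1\<in>flow_maps \<B> s. \<exists>\<Phi>2\<in>flow_maps \<B> t. \<Phi> = \<Phi>2 \<circ> \<Phi>1"
proof -
  obtain A where A: "control \<B> A" "\<Phi> = (\<lambda>v. flow A v (s + t))"
    using assms by (auto simp: flow_maps_def)
  have "\<Phi> = (\<lambda>v. flow (\<lambda>r. A (s + r)) v t) \<circ> (\<lambda>v. flow A v s)"
    using flow_shift[OF A(1) assms(2,3)] by (simp add: A(2) o_def)
  then show ?thesis using control_shift[OF A(1), of s] A(1) unfolding flow_maps_def by blast
qed

text \<open>A control is chosen for every point of \<open>X\<close>, and the choices are applied in
  turn along the points \<open>y k\<close> that they produce. \<open>Q\<close> records what a choice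
  achieves from its starting point. This serves to repeat near-optimal growth, and to prolong
  trajectories of exact growth from unit time to all times.\<close>

lemma flow_chain:
  assumes T: "0 < T" and v: "v \<in> X"
    and step: "\<And>u. u \<in> X \<Longrightarrow> \<exists>A. control \<B> A \<and> flow A u T \<in> X \<and> Q u A"
  obtains C where "control \<B> C"
    and "\<And>k. flow C v (real k * T) \<in> X"
    and "\<And>k. \<exists>A. control \<B> A \<and> Q (flow C v (real k * T)) A \<and>
          (\<forall>t\<in>{0..T}. flow C v (real k * T + t) = flow A (flow C v (real k * T)) t)"
proof -
  from step obtain f where f: "\<And>u. u \<in> X \<Longrightarrow> control \<B> (f u) \<and> flow (f u) u T \<in> X \<and> Q u (f u)" by metis
  define y where "y = rec_nat v (\<lambda>_ u. flow (f u) u T)"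
  have y0: "y 0 = v" and ySuc: "y (Suc k) = flow (f (y k)) (y k) T" for k by (simp_all add: y_def)
  have yX: "y k \<in> X" for k by (induction k) (use v f in \<open>auto simp: y0 ySuc\<close>)
  define C where "C s = f (y (nat \<lfloor>s / T\<rfloor>)) (- (real (nat \<lfloor>s / T\<rfloor>) * T) + s)" for s
  have C: "control \<B> C" unfolding C_def by (rule control_concat) (use f yX in auto)
  have seg: "flow (\<lambda>s. C (real k * T + s)) u t = flow (f (y k)) u t" if t: "t \<in> {0..T}" for k u t
  proof (rule flow_cong)
    fix s assume s: "s \<in> {0..<t}"
    have "\<lfloor>(real k * T + s) / T\<rfloor> = int k"
      using s t T by (intro floor_unique) (auto simp: field_simps)
    then show "C (real k * T + s) = f (y k) s" by (simp add: C_def)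
  qed (use t f yX control_shift[OF C] in auto)
  have seg': "flow C v (real k * T + t) = flow (f (y k)) (flow C v (real k * T)) t" if t: "t \<in> {0..T}" for k t
    using flow_shift[OF C, of "real k * T" t v] seg[OF t] T t by simp
  have Cy: "flow C v (real k * T) = y k" for k
  proof (induction k)
    case (Suc k)
    have "flow C v (real (Suc k) * T) = flow C v (real k * T + T)" by (simp add: algebra_simps)
    then show ?case using seg'[of T k] T Suc by (simp add: ySuc)
  qed (simp add: flow_0[OF C] y0)
  show ?thesis
  proof (rule that[OF C])
    fix k
    show "flow C v (real k * T) \<in> X" using yX by (simp add: Cy)
    show "\<exists>A. control \<B> A \<and> Q (flow C v (real k * T)) A \<and>
          (\<forall>t\<in>{0..T}. flow C v (real k * T + t) = flow A (flow C v (real k * T)) t)"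
      using f[OF yX[of k]] seg' by (intro exI[of _ "f (y k)"]) (auto simp: Cy)
  qed
qed

end

section \<open>Limits of trajectories\<close>

text \<open>Almost minimal elements for the \<open>L\<^sup>2\<close> norm form a Cauchy sequence by the parallelogram law. This replaces weak compactness of the set of controls.\<close>

lemma midpoint_family_AE_convergent:
  fixes G :: "nat \<Rightarrow> ('b \<Rightarrow> 'e::euclidean_space) set"
  assumes N: "finite_measure N"
    and decr: "\<And>m n. m \<le> n \<Longrightarrow> G n \<subseteq> G m" and nonempty: "\<And>n. G n \<noteq> {}"
    and mid: "\<And>n f g. f \<in> G n \<Longrightarrow> g \<in> G n \<Longrightarrow> (\<lambda>s. (1 / 2) *\<^sub>R (f s + g s)) \<in> G n"
    and meas: "\<And>n f. f \<in> G n \<Longrightarrow> f \<in> borel_measurable N"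
    and bound: "\<And>n f s. f \<in> G n \<Longrightarrow> norm (f s) \<le> R"
  obtains f where "\<And>n. f n \<in> G n" "AE s in N. convergent (\<lambda>n. f n s)"
proof -
  interpret finite_measure N by fact
  define J where "J f = (LINT s|N. (norm (f s))\<^sup>2)" for f :: "'b \<Rightarrow> 'e"
  have R0: "0 \<le> R" using bound nonempty norm_ge_zero order_trans by (metis ex_in_conv)
  have int_sq: "integrable N (\<lambda>s. (norm (f s))\<^sup>2)" if "f \<in> G n" for f n
  proof (rule integrable_const_bound)
    show "AE s in N. norm ((norm (f s))\<^sup>2) \<le> R\<^sup>2"
      using bound[OF that] by (intro AE_I2) (simp add: power_mono)
    show "(\<lambda>s. (norm (f s))\<^sup>2) \<in> borel_measurable N" using meas[OF that] by measurable
  qed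
  have J0: "0 \<le> J f" for f unfolding J_def by (intro integral_nonneg_AE AE_I2) simp
  have JR: "J f \<le> R\<^sup>2 * measure N (space N)" if "f \<in> G n" for f n
  proof -
    have "J f \<le> (LINT s|N. R\<^sup>2)" unfolding J_def
      using bound[OF that] by (intro integral_mono int_sq[OF that]) (auto simp: power_mono)
    then show ?thesis by (simp add: mult.commute)
  qed
  \<comment> \<open>The families shrink, so their infimal energies \<open>d n\<close> increase;
    being bounded they form a Cauchy sequence, which makes almost minimal elements of different
    families comparable.\<close>
  define d where "d n = (INF f\<in>G n. J f)" for n
  have bb: "bdd_below (J ` G n)" for n using J0 by (intro bdd_belowI2)
  have d_le: "d n \<le> J f" if "f \<in> G n" for n f unfolding d_def by (rule cINF_lower[OF bb that])
  have d_mono: "d m \<le> d n" if "m \<le> n" for m n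
    unfolding d_def using decr[OF that] nonempty by (intro cINF_superset_mono bb) auto
  have "d n \<le> R\<^sup>2 * measure N (space N)" for n
    using nonempty[of n] d_le JR by (meson ex_in_conv order_trans)
  then have "convergent d" using d_mono by (intro Bseq_mono_convergent BseqI'[where K = "R\<^sup>2 * measure N (space N)"])
      (auto simp: d_def abs_of_nonneg cINF_greatest[OF nonempty J0])
  then have "Cauchy d" by (rule convergent_Cauchy)
  have "\<exists>f\<in>G n. J f < d n + 1 / real (Suc n)" for n
    using cInf_lessD[of "J ` G n" "d n + 1 / real (Suc n)"] nonempty[of n] by (auto simp: d_def)
  then obtain h where h: "\<And>n. h n \<in> G n" "\<And>n. J (h n) < d n + 1 / real (Suc n)" by metis
  have int_h: "integrable N (h n)" for n
    using bound[OF h(1)] by (intro integrable_const_bound[where B = R] meas[OF h(1)]) auto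
  have par: "J (\<lambda>s. h i s - h j s) \<le> 2 * J (h i) + 2 * J (h j) - 4 * d n" if "n \<le> i" "n \<le> j" for i j n
  proof -
    define g where "g s = (1 / 2) *\<^sub>R (h i s + h j s)" for s
    have g: "g \<in> G n" unfolding g_def using h(1) decr that by (intro mid) blast+
    have "norm (h i s - h j s) ^ 2 = 2 * norm (h i s) ^ 2 + 2 * norm (h j s) ^ 2 - 4 * norm (g s) ^ 2" for s
      unfolding power2_norm_eq_inner g_def
      by (simp add: inner_add_left inner_add_right inner_diff_left inner_diff_right inner_commute algebra_simps)
    then have "J (\<lambda>s. h i s - h j s) = 2 * J (h i) + 2 * J (h j) - 4 * J g"
      unfolding J_def using int_sq[OF h(1)] int_sq[OF g] by simp
    then show ?thesis using d_le[OF g] by simp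
  qed
  have L1: "\<exists>n. \<forall>i\<ge>n. \<forall>j\<ge>n. LINT s|N. norm (h i s - h j s) < \<epsilon>" if \<epsilon>: "\<epsilon> > 0" for \<epsilon>
  proof -
    \<comment> \<open>\<open>\<delta>\<close> is the weight in
      \<open>2 * \<delta> * u \<le> \<delta> * \<delta> + u\<^sup>2\<close>, which passes from the
      quadratic energy to the \<open>L1\<close> distance on a space of finite measure.\<close>
    define \<delta> where "\<delta> = \<epsilon> / (measure N (space N) + 1)"
    have \<mu>: "0 \<le> measure N (space N)" by simp
    have \<delta>: "\<delta> > 0" using \<epsilon> \<mu> by (simp add: \<delta>_def add_nonneg_pos)
    \<comment> \<open>Two near-minimality errors and two differences of infima, each doubled, make
      up eight times \<open>\<eta>\<close>.\<close>
    define \<eta> where "\<eta> = \<delta> * \<epsilon> / 8"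
    have \<eta>: "\<eta> > 0" using \<delta> \<epsilon> by (simp add: \<eta>_def)
    obtain n1 where n1: "\<And>i j. n1 \<le> i \<Longrightarrow> n1 \<le> j \<Longrightarrow> dist (d i) (d j) < \<eta>"
      using metric_CauchyD[OF \<open>Cauchy d\<close> \<eta>] by blast
    obtain n2 where n2: "1 / real (Suc n2) < \<eta>" using nat_approx_posE[OF \<eta>] .
    define n where "n = max n1 n2"
    have "LINT s|N. norm (h i s - h j s) < \<epsilon>" if ij: "n \<le> i" "n \<le> j" for i j
    proof -
      have one: "1 / real (Suc k) < \<eta>" if "n \<le> k" for k
      proof -
        have "1 / real (Suc k) \<le> 1 / real (Suc n2)" using that by (intro divide_left_mono) (auto simp: n_def)
        with n2 show ?thesis by simp
      qed
      have "d i \<le> d n + \<eta>" "d j \<le> d n + \<eta>"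
        using n1[of i n] n1[of j n] ij by (auto simp: n_def dist_real_def)
      then have Jij: "J (\<lambda>s. h i s - h j s) < \<delta> * \<epsilon>"
        using par[OF ij] h(2)[of i] h(2)[of j] one[OF ij(1)] one[OF ij(2)] by (simp add: \<eta>_def)
      have sq: "integrable N (\<lambda>s. (norm (h i s - h j s))\<^sup>2)"
      proof (rule integrable_const_bound[where B = "(R + R)\<^sup>2"])
        have "norm (h i s - h j s) \<le> R + R" for s
          using norm_triangle_ineq4[of "h i s" "h j s"] bound[OF h(1), of i s] bound[OF h(1), of j s] by linarith
        then have "(norm (h i s - h j s))\<^sup>2 \<le> (R + R)\<^sup>2" for s by (intro power_mono) auto
        then show "AE s in N. norm ((norm (h i s - h j s))\<^sup>2) \<le> (R + R)\<^sup>2"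
          unfolding real_norm_def abs_power2 by (intro AE_I2)
        show "(\<lambda>s. (norm (h i s - h j s))\<^sup>2) \<in> borel_measurable N"
          using meas[OF h(1), of i] meas[OF h(1), of j] by measurable
      qed
      have "LINT s|N. norm (h i s - h j s) \<le> LINT s|N. \<delta> / 2 + (norm (h i s - h j s))\<^sup>2 / (2 * \<delta>)"
      proof (rule integral_mono)
        show "integrable N (\<lambda>s. norm (h i s - h j s))" by (intro integrable_norm Bochner_Integration.integrable_diff int_h)
        show "integrable N (\<lambda>s. \<delta> / 2 + (norm (h i s - h j s))\<^sup>2 / (2 * \<delta>))"
          using sq by simp
        fix s
        have "0 \<le> (norm (h i s - h j s) - \<delta>)\<^sup>2" by simp
        then have "2 * \<delta> * norm (h i s - h j s) \<le> \<delta> * \<delta> + (norm (h i s - h j s))\<^sup>2"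
          by (simp add: power2_eq_square algebra_simps)
        then have "norm (h i s - h j s) \<le> (\<delta> * \<delta> + (norm (h i s - h j s))\<^sup>2) / (2 * \<delta>)"
          using \<delta> by (subst pos_le_divide_eq) (auto simp: mult.commute)
        then show "norm (h i s - h j s) \<le> \<delta> / 2 + (norm (h i s - h j s))\<^sup>2 / (2 * \<delta>)"
          using \<delta> by (simp add: add_divide_distrib)
      qed
      also have "\<dots> = \<delta> / 2 * measure N (space N) + J (\<lambda>s. h i s - h j s) / (2 * \<delta>)"
        using sq by (simp add: J_def mult.commute)
      also have "\<dots> < \<epsilon> / 2 + \<epsilon> / 2"
      proof (rule add_le_less_mono)
        have "measure N (space N) * \<delta> \<le> (measure N (space N) + 1) * \<delta>"
          using \<delta> by (intro mult_right_mono) auto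
        also have "\<dots> = \<epsilon>" using add_nonneg_pos[OF \<mu>, of 1] by (simp add: \<delta>_def)
        finally have "measure N (space N) * \<delta> \<le> \<epsilon>" .
        then show "\<delta> / 2 * measure N (space N) \<le> \<epsilon> / 2" by (simp add: mult.commute)
        show "J (\<lambda>s. h i s - h j s) / (2 * \<delta>) < \<epsilon> / 2"
          using Jij \<delta> by (subst pos_divide_less_eq) (auto simp: mult_ac)
      qed
      finally show ?thesis by simp
    qed
    then show ?thesis by blast
  qed
  obtain r where r: "strict_mono r" "AE s in N. Cauchy (\<lambda>i. h (r i) s)"
    by (rule cauchy_L1_AE_cauchy_subseq[OF int_h L1])
  show ?thesis
  proof (rule that[of "\<lambda>n. h (r n)"])
    show "h (r n) \<in> G n" for n using h(1)[of "r n"] decr[OF seq_suble[OF r(1), of n]] by blast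
    show "AE s in N. convergent (\<lambda>n. h (r n) s)" using r(2) by (simp add: Cauchy_convergent_iff)
  qed
qed

context bounded_operators begin

lemma flow_lipschitz:
  assumes A: "control \<B> A" and st: "0 \<le> s" "s \<le> t" "t \<le> T"
  shows "norm (flow A v t - flow A v s) \<le> M * (exp (M * T) * norm v) * (t - s)"
proof (rule solves_on_lipschitz[OF A flow_solves_on[OF A] _ st])
  fix r assume r: "r \<in> {0..T}"
  have "norm (flow A v r) \<le> exp (M * r) * norm v" using r by (intro flow_norm_le A) auto
  also have "\<dots> \<le> exp (M * T) * norm v" using r M_nonneg by (auto intro!: mult_right_mono mult_left_mono)
  finally show "norm (flow A v r) \<le> exp (M * T) * norm v" .
qed

text \<open>The states converge by Arzela-Ascoli, but the controls \<open>A n\<close> need not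
  converge pointwise. A control for the limit \<open>x\<close> is found separately:
  \<open>G n\<close> collects the controls in the hull whose equation \<open>x\<close> satisfies up
  to an error of order \<open>1 / (n + 1)\<close>. It contains \<open>A (k m)\<close> for suitable
  \<open>m\<close> and is closed under midpoints, so an almost everywhere convergent selection
  exists.\<close>

lemma relaxed_limit_trajectory:
  assumes comp: "compact \<B>" and A: "\<And>n::nat. control \<B> (A n)" and T: "0 \<le> T"
  obtains f x k where "control (convex hull \<B>) f" "solves_on T f x" "x 0 = v" "strict_mono (k :: nat \<Rightarrow> nat)"
    "\<And>t. t \<in> {0..T} \<Longrightarrow> (\<lambda>n. flow (A (k n)) v t) \<longlonglongrightarrow> x t"
proof -
  let ?C = "convex hull \<B>"
  interpret hull: bounded_operators ?C M by (rule bounded_operators_convex_hull)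
  define E where "E = exp (M * T) * norm v"
  have E0: "0 \<le> E" by (simp add: E_def)
  have flowE: "norm (flow (A n) v t) \<le> E" if "t \<in> {0..T}" for n t
  proof -
    have "norm (flow (A n) v t) \<le> exp (M * t) * norm v" using that by (intro flow_norm_le A) auto
    also have "\<dots> \<le> E" unfolding E_def using that M_nonneg by (auto intro!: mult_right_mono mult_left_mono)
    finally show ?thesis .
  qed
  have lip: "norm (flow (A n) v s - flow (A n) v t) \<le> M * E * \<bar>s - t\<bar>" if "s \<in> {0..T}" "t \<in> {0..T}" for n s t
    using flow_lipschitz[OF A, of s t T n v] flow_lipschitz[OF A, of t s T n v] that
    unfolding E_def by (cases "s \<le> t") (auto simp: norm_minus_commute)
  obtain x k where xcont: "continuous_on {0..T} x" and k: "strict_mono (k :: nat \<Rightarrow> nat)"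
    and unif: "\<And>e. 0 < e \<Longrightarrow> \<exists>N. \<forall>n t. n \<ge> N \<and> t \<in> {0..T} \<longrightarrow> norm (flow (A (k n)) v t - x t) < e"
  proof (rule Arzela_Ascoli[of "{0..T}" "\<lambda>n. flow (A n) v" E])
    fix s e :: real assume s: "s \<in> {0..T}" and e: "0 < e"
    show "\<exists>d>0. \<forall>n t. t \<in> {0..T} \<and> norm (s - t) < d \<longrightarrow> norm (flow (A n) v s - flow (A n) v t) < e"
    proof (intro exI[of _ "e / (M * E + 1)"] conjI allI impI)
      have ME: "0 < M * E + 1" using M_nonneg E0 by (simp add: add_nonneg_pos)
      then show "0 < e / (M * E + 1)" using e by simp
      fix n t assume t: "t \<in> {0..T} \<and> norm (s - t) < e / (M * E + 1)"
      have "norm (flow (A n) v s - flow (A n) v t) \<le> M * E * \<bar>s - t\<bar>" using lip s t by blast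
      also have "\<dots> \<le> (M * E + 1) * \<bar>s - t\<bar>" by (intro mult_right_mono) auto
      also have "\<dots> < (M * E + 1) * (e / (M * E + 1))" using t ME by (intro mult_strict_left_mono) auto
      finally show "norm (flow (A n) v s - flow (A n) v t) < e" using ME by simp
    qed
  qed (use flowE that in auto)
  have conv: "(\<lambda>n. flow (A (k n)) v t) \<longlonglongrightarrow> x t" if "t \<in> {0..T}" for t
    using unif that by (intro LIMSEQ_I) blast
  have xint: "(\<lambda>s. g s *v x s) integrable_on {0..t}" if "control ?C g" "t \<in> {0..T}" for g t
    using hull.control_integrable[OF that(1) continuous_on_subset[OF xcont, of "{0..t}"]] that(2)
    by (simp add: absolutely_integrable_on_def)
  \<comment> \<open>Solving the equation for the limit \<open>x\<close> up to a given error is a convex condition on the control, although the solution depends nonlinearly on the control.\<close>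
  define G where "G n = {g. control ?C g \<and>
      (\<forall>t\<in>{0..T}. norm (x t - v - integral {0..t} (\<lambda>s. g s *v x s)) \<le> (1 + M * T) / real (Suc n))}" for n
  have AC: "control ?C (A n)" for n using A[of n] hull_subset[of \<B> convex] by (auto simp: control_def)
  obtain R where R: "\<And>X. X \<in> ?C \<Longrightarrow> norm X \<le> R" using hull.bounded by (auto simp: bounded_iff)
  have closedC: "closed ?C" using comp by (intro compact_imp_closed compact_convex_hull)
  obtain f where f: "\<And>n. f n \<in> G n" "AE s in lebesgue_on {0..T}. convergent (\<lambda>n. f n s)"
  proof (rule midpoint_family_AE_convergent[of "lebesgue_on {0..T}" G R])
    show "finite_measure (lebesgue_on {0..T})" by (rule finite_measure_lebesgue_on) auto
    show "G n \<subseteq> G m" if "m \<le> n" for m n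
    proof -
      have "(1 + M * T) / real (Suc n) \<le> (1 + M * T) / real (Suc m)"
        using that M_nonneg T by (intro divide_left_mono) auto
      then show ?thesis unfolding G_def by (blast intro: order_trans)
    qed
    show "G n \<noteq> {}" for n
    proof -
      define \<delta> where "\<delta> = 1 / real (Suc n)"
      have \<delta>: "0 < \<delta>" by (simp add: \<delta>_def)
      then obtain m where m: "\<And>t. t \<in> {0..T} \<Longrightarrow> norm (flow (A (k m)) v t - x t) < \<delta>" using unif by blast
      let ?y = "flow (A (k m)) v"
      have "norm (x t - v - integral {0..t} (\<lambda>s. A (k m) s *v x s)) \<le> (1 + M * T) / real (Suc n)"
        if t: "t \<in> {0..T}" for t
      proof -
        have y: "solves_on t (A (k m)) ?y" by (rule flow_solves_on[OF A])
        have yint: "(\<lambda>s. A (k m) s *v ?y s) integrable_on {0..t}"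
          using control_integrable[OF A solves_on_continuous[OF y]] t by (auto simp: absolutely_integrable_on_def)
        have "?y t = v + integral {0..t} (\<lambda>s. A (k m) s *v ?y s)"
          using solves_on_eq[OF y, of t] t by (simp add: flow_0[OF A])
        then have "x t - v - integral {0..t} (\<lambda>s. A (k m) s *v x s)
            = (x t - ?y t) + integral {0..t} (\<lambda>s. A (k m) s *v ?y s - A (k m) s *v x s)"
          using Henstock_Kurzweil_Integration.integral_diff[OF yint xint[OF AC t]] by simp
        also have "norm \<dots> \<le> norm (x t - ?y t) + norm (integral {0..t} (\<lambda>s. A (k m) s *v ?y s - A (k m) s *v x s))"
          by (rule norm_triangle_ineq)
        also have "norm (integral {0..t} (\<lambda>s. A (k m) s *v ?y s - A (k m) s *v x s)) \<le> integral {0..t} (\<lambda>s. M * \<delta>)"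
        proof (intro integral_norm_bound_integral integrable_diff yint xint[OF AC t])
          fix s assume s: "s \<in> {0..t}"
          have "norm (A (k m) s *v ?y s - A (k m) s *v x s) \<le> M * norm (?y s - x s)"
            using M_control[OF A, of "k m" s "?y s - x s"] by (simp add: matrix_vector_mult_diff_distrib)
          also have "\<dots> \<le> M * \<delta>" using m[of s] s t M_nonneg by (intro mult_left_mono) auto
          finally show "norm (A (k m) s *v ?y s - A (k m) s *v x s) \<le> M * \<delta>" .
        qed auto
        also have "integral {0..t} (\<lambda>s. M * \<delta>) = M * t * \<delta>" using t by simp
        also have "M * t * \<delta> \<le> M * T * \<delta>" using t \<delta> M_nonneg by (intro mult_right_mono mult_left_mono) auto
        also have "norm (x t - ?y t) \<le> \<delta>" using m[OF t] by (simp add: norm_minus_commute)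
        finally show ?thesis by (simp add: \<delta>_def add_divide_distrib)
      qed
      then have "A (k m) \<in> G n" using AC by (simp add: G_def)
      then show ?thesis by blast
    qed
    show "(\<lambda>s. (1 / 2) *\<^sub>R (g s + h s)) \<in> G n" if g: "g \<in> G n" and h: "h \<in> G n" for n g h
    proof -
      have gc: "control ?C g" and hc: "control ?C h" using g h by (auto simp: G_def)
      have "(1 / 2) *\<^sub>R (g s + h s) \<in> ?C" for s
        using convexD[OF convex_convex_hull[of \<B>], of "g s" "h s" "1/2" "1/2"] gc hc
        by (auto simp: control_def scaleR_add_right)
      moreover have "(\<lambda>s. (1 / 2) *\<^sub>R (g s + h s)) \<in> borel_measurable lebesgue"
        using gc hc unfolding control_def by (intro borel_measurable_scaleR borel_measurable_add) auto
      ultimately have mc: "control ?C (\<lambda>s. (1 / 2) *\<^sub>R (g s + h s))" by (auto simp: control_def)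
      have "norm (x t - v - integral {0..t} (\<lambda>s. ((1 / 2) *\<^sub>R (g s + h s)) *v x s)) \<le> (1 + M * T) / real (Suc n)"
        if t: "t \<in> {0..T}" for t
      proof -
        let ?g = "integral {0..t} (\<lambda>s. g s *v x s)" and ?h = "integral {0..t} (\<lambda>s. h s *v x s)"
        have "integral {0..t} (\<lambda>s. ((1 / 2) *\<^sub>R (g s + h s)) *v x s)
            = integral {0..t} (\<lambda>s. (1 / 2) *\<^sub>R (g s *v x s + h s *v x s))"
          unfolding scaleR_matrix_vector_assoc[symmetric] matrix_vector_mult_add_rdistrib ..
        also have "\<dots> = (1 / 2) *\<^sub>R (?g + ?h)"
          using Henstock_Kurzweil_Integration.integral_add[OF xint[OF gc t] xint[OF hc t]] by simp
        finally have "x t - v - integral {0..t} (\<lambda>s. ((1 / 2) *\<^sub>R (g s + h s)) *v x s)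
            = (1 / 2) *\<^sub>R (x t - v - ?g) + (1 / 2) *\<^sub>R (x t - v - ?h)"
          by (simp add: vec_eq_iff field_simps)
        also have "norm \<dots> \<le> 1 / 2 * norm (x t - v - ?g) + 1 / 2 * norm (x t - v - ?h)"
          by (rule norm_triangle_le) simp
        also have "\<dots> \<le> 1 / 2 * ((1 + M * T) / real (Suc n)) + 1 / 2 * ((1 + M * T) / real (Suc n))"
          using g h t by (intro add_mono mult_left_mono) (auto simp: G_def)
        also have "\<dots> = (1 + M * T) / real (Suc n)" unfolding distrib_right[symmetric] by simp
        finally show ?thesis .
      qed
      then show ?thesis using mc by (simp add: G_def)
    qed
    show "g \<in> borel_measurable (lebesgue_on {0..T})" if "g \<in> G n" for n g
      using that by (auto simp: G_def control_def intro: measurable_restrict_space1)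
    show "norm (g s) \<le> R" if "g \<in> G n" for n g s
      using that R by (auto simp: G_def control_def)
  qed (rule that)
  from f(2) obtain Z where Z: "Z \<in> null_sets (lebesgue_on {0..T})"
      "{s \<in> space (lebesgue_on {0..T}). \<not> convergent (\<lambda>n. f n s)} \<subseteq> Z"
    unfolding eventually_ae_filter by blast
  have Zs: "Z \<in> sets lebesgue" "negligible Z"
    using Z(1) by (auto simp: null_sets_restrict_space negligible_iff_null_sets)
  have fc: "control ?C (f n)" for n using f(1)[of n] by (simp add: G_def)
  define X where "X = {0..T} - Z"
  have X: "X \<in> sets lebesgue" using Zs by (auto simp: X_def)
  have Xconv: "convergent (\<lambda>n. f n s)" if "s \<in> X" for s using Z(2) that by (auto simp: X_def)
  \<comment> \<open>Off the convergence set the values of \<open>A 0\<close> serve as a default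
    within the hull; inside \<open>{0..T}\<close> this concerns only a null set.\<close>
  define g where "g s = (if s \<in> X then lim (\<lambda>n. f n s) else A 0 s)" for s
  have glim: "(\<lambda>n. f n s) \<longlonglongrightarrow> g s" if "s \<in> X" for s
    using Xconv[OF that] that by (simp add: g_def convergent_LIMSEQ_iff)
  have "g s \<in> ?C" for s
  proof (cases "s \<in> X")
    case True
    show ?thesis
      by (rule closed_sequentially[OF closedC _ glim[OF True]]) (use fc in \<open>auto simp: control_def\<close>)
  qed (use AC[of 0] in \<open>auto simp: g_def control_def\<close>)
  moreover have "g \<in> borel_measurable lebesgue"
    unfolding g_def using fc AC[of 0] X unfolding control_def
    by (intro measurable_If_set borel_measurable_lim_metric) auto
  ultimately have gc: "control ?C g" by (auto simp: control_def)
  have xeq: "x t = v + integral {0..t} (\<lambda>s. g s *v x s)" if t: "t \<in> {0..T}" for t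
  proof -
    define P where "P n s = (if s \<in> Z then 0 else f n s *v x s)" for n s
    define P' where "P' s = (if s \<in> Z then 0 else g s *v x s)" for s
    have P: "integral {0..t} (P n) = integral {0..t} (\<lambda>s. f n s *v x s)" for n
      by (rule integral_spike[OF Zs(2)]) (auto simp: P_def)
    have P': "integral {0..t} P' = integral {0..t} (\<lambda>s. g s *v x s)"
      by (rule integral_spike[OF Zs(2)]) (auto simp: P'_def)
    have "(\<lambda>n. integral {0..t} (P n)) \<longlonglongrightarrow> integral {0..t} P'"
    proof (rule dominated_convergence(2))
      show "P n integrable_on {0..t}" for n
        by (rule integrable_spike[OF xint[OF fc t] Zs(2)]) (auto simp: P_def)
      show "(\<lambda>s. M * norm (x s)) integrable_on {0..t}"
        using continuous_on_subset[OF xcont, of "{0..t}"] t by (intro integrable_continuous_real continuous_intros) auto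
      show "norm (P n s) \<le> M * norm (x s)" for n s
        using hull.M_control[OF fc, of n s "x s"] M_nonneg by (simp add: P_def)
      fix s assume s: "s \<in> {0..t}"
      show "(\<lambda>n. P n s) \<longlonglongrightarrow> P' s"
      proof (cases "s \<in> Z")
        case False
        then have "s \<in> X" using s t by (simp add: X_def)
        from bounded_linear.tendsto[OF bounded_bilinear.bounded_linear_left[OF bounded_bilinear_matrix_vector_mult] glim[OF this]]
        show ?thesis using False by (simp add: P_def P'_def)
      qed (simp add: P_def P'_def)
    qed
    then have lim: "(\<lambda>n. norm (x t - v - integral {0..t} (\<lambda>s. f n s *v x s))) \<longlonglongrightarrow> norm (x t - v - integral {0..t} (\<lambda>s. g s *v x s))"
      unfolding P P' by (intro tendsto_intros)
    have "(\<lambda>n. (1 + M * T) / real (Suc n)) \<longlonglongrightarrow> 0" by (intro LIMSEQ_Suc[OF lim_const_over_n])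
    from LIMSEQ_le[OF lim this] have "norm (x t - v - integral {0..t} (\<lambda>s. g s *v x s)) \<le> 0"
      using f(1) t by (auto simp: G_def)
    then show ?thesis by (simp add: algebra_simps)
  qed
  have x0: "x 0 = v" using xeq[of 0] T by simp
  have "solves_on T g x" unfolding solves_on_def x0 by (intro conjI xcont ballI xeq)
  with gc show ?thesis using x0 k conv by (rule that)
qed

end

section \<open>Irreducible semigroups of positive maps\<close>

text \<open>Pointedness makes \<open>K - {0}\<close> convex, so the convex hull of the unit vectors
  of \<open>K\<close> is a compact set missing the origin. A strictly separating functional is
  bounded below on it by a positive number, and scaling gives the bound on \<open>K\<close>.\<close>

lemma pointed_cone_functional:
  fixes K :: "'a::euclidean_space set"
  assumes K: "cone K" "convex K" "closed K" "K \<inter> uminus ` K = {0}"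
  obtains e a where "a > 0" "\<And>x. x \<in> K \<Longrightarrow> a * norm x \<le> e \<bullet> x"
proof -
  have scale: "c *\<^sub>R x \<in> K" if "x \<in> K" "0 \<le> c" for c x using K(1) that by (auto simp: cone_def)
  have "convex (K - {0})"
  proof (rule convexI)
    fix x y :: 'a and u v :: real
    assume xy: "x \<in> K - {0}" "y \<in> K - {0}" and uv: "0 \<le> u" "0 \<le> v" "u + v = 1"
    have "u *\<^sub>R x + v *\<^sub>R y \<noteq> 0"
    proof
      assume 0: "u *\<^sub>R x + v *\<^sub>R y = 0"
      have "u *\<^sub>R x = - (v *\<^sub>R y)" using 0 by (simp add: eq_neg_iff_add_eq_0)
      moreover have "u *\<^sub>R x \<in> K" "v *\<^sub>R y \<in> K" using xy uv by (auto intro: scale)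
      ultimately have "u *\<^sub>R x \<in> K \<inter> uminus ` K" by auto
      then have "u *\<^sub>R x = 0" using K(4) by auto
      then show False using 0 xy uv by auto
    qed
    then show "u *\<^sub>R x + v *\<^sub>R y \<in> K - {0}" using K(2) xy uv by (auto simp: convex_def)
  qed
  then have "convex hull (K \<inter> sphere 0 1) \<subseteq> K - {0}" by (intro hull_minimal) auto
  moreover have "closed (convex hull (K \<inter> sphere 0 1))"
    by (rule compact_imp_closed[OF compact_convex_hull[OF closed_Int_compact[OF K(3) compact_sphere]]])
  moreover from calculation have "0 \<notin> convex hull (K \<inter> sphere 0 1)" by blast
  ultimately have "\<exists>e b. e \<noteq> 0 \<and> 0 < b \<and> (\<forall>x\<in>convex hull (K \<inter> sphere 0 1). b < e \<bullet> x)"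
    by (intro separating_hyperplane_closed_0 convex_convex_hull)
  then obtain e b where eb: "0 < b" "\<And>x. x \<in> convex hull (K \<inter> sphere 0 1) \<Longrightarrow> b < e \<bullet> x"
    by blast
  have "b * norm x \<le> e \<bullet> x" if x: "x \<in> K" for x
  proof (cases "x = 0")
    case False
    have "(1 / norm x) *\<^sub>R x \<in> convex hull (K \<inter> sphere 0 1)"
      using x False by (intro hull_inc) (auto intro: scale)
    from eb(2)[OF this] False show ?thesis by (simp add: field_simps)
  qed simp
  with eb(1) that show ?thesis by blast
qed

text \<open>\<open>w\<close> is the centre of a ball of radius \<open>r\<close> inside the cone, and
  \<open>\<kappa>\<close> is \<open>1 / r\<close>.\<close>

lemma solid_cone_order_unit:
  fixes K :: "'a::euclidean_space set"
  assumes K: "cone K" "interior K \<noteq> {}"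
  obtains w \<kappa> where "w \<in> K" "\<kappa> > 0" "\<And>z. (\<kappa> * norm z) *\<^sub>R w - z \<in> K"
proof -
  obtain w where w: "w \<in> interior K" using K by auto
  then obtain r where r: "r > 0" "cball w r \<subseteq> K" unfolding mem_interior_cball by auto
  have scale: "c *\<^sub>R x \<in> K" if "x \<in> K" "0 \<le> c" for c x using K(1) that by (auto simp: cone_def)
  have wK: "w \<in> K" using r by auto
  show ?thesis
  proof (rule that[OF wK, of "1 / r"])
    fix z
    show "(1 / r * norm z) *\<^sub>R w - z \<in> K"
    proof (cases "z = 0")
      case True
      then show ?thesis using scale[OF wK, of 0] by simp
    next
      case False
      have "w - (r / norm z) *\<^sub>R z \<in> K" using r False by (auto simp: dist_norm intro!: subsetD[OF r(2)])
      then have "(norm z / r) *\<^sub>R (w - (r / norm z) *\<^sub>R z) \<in> K" using r by (intro scale) auto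
      then show ?thesis using r False by (simp add: scaleR_diff_right)
    qed
  qed (use r in auto)
qed

text \<open>Since the cone is pointed and solid, its order has a strictly positive functional \<open>e\<close> and an order unit \<open>w\<close>; \<open>F t\<close> measures the maximal growth at time \<open>t\<close> in terms of these two.\<close>

locale positive_semigroup =
  fixes K :: "'a::euclidean_space set" and S :: "real \<Rightarrow> ('a \<Rightarrow> 'a) set"
    and M :: real and e w :: 'a and a \<kappa> :: real
  assumes K_cone: "cone K" and K_convex: "convex K" and K_closed: "closed K"
    and K_pointed: "K \<inter> uminus ` K = {0}"
    and a_pos: "a > 0" and e_ge: "\<And>x. x \<in> K \<Longrightarrow> a * norm x \<le> e \<bullet> x"
    and w_mem: "w \<in> K" and \<kappa>_pos: "\<kappa> > 0" and w_unit: "\<And>z. (\<kappa> * norm z) *\<^sub>R w - z \<in> K"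
    and M_nonneg: "0 \<le> M"
    and S_linear: "\<And>\<Phi> t. 0 \<le> t \<Longrightarrow> \<Phi> \<in> S t \<Longrightarrow> linear \<Phi>"
    and S_positive: "\<And>\<Phi> t x. 0 \<le> t \<Longrightarrow> \<Phi> \<in> S t \<Longrightarrow> x \<in> K \<Longrightarrow> \<Phi> x \<in> K"
    and S_norm_le: "\<And>\<Phi> t x. 0 \<le> t \<Longrightarrow> \<Phi> \<in> S t \<Longrightarrow> norm (\<Phi> x) \<le> exp (M * t) * norm x"
    and S_norm_ge: "\<And>\<Phi> t x. 0 \<le> t \<Longrightarrow> \<Phi> \<in> S t \<Longrightarrow> exp (- M * t) * norm x \<le> norm (\<Phi> x)"
    and S_nonempty: "\<And>t. 0 \<le> t \<Longrightarrow> S t \<noteq> {}"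
    and S_comp: "\<And>\<Phi> \<Psi> s t. 0 \<le> s \<Longrightarrow> 0 \<le> t \<Longrightarrow> \<Phi> \<in> S s \<Longrightarrow> \<Psi> \<in> S t \<Longrightarrow> \<Psi> \<circ> \<Phi> \<in> S (s + t)"
    and S_split: "\<And>\<Phi> s t. 0 \<le> s \<Longrightarrow> 0 \<le> t \<Longrightarrow> \<Phi> \<in> S (s + t) \<Longrightarrow> \<exists>\<Phi>1\<in>S s. \<exists>\<Phi>2\<in>S t. \<Phi> = \<Phi>2 \<circ> \<Phi>1"
    and S_irreducible: "\<And>y q. y \<in> K \<Longrightarrow> y \<noteq> 0 \<Longrightarrow> (\<And>x. x \<in> K \<Longrightarrow> 0 \<le> q \<bullet> x) \<Longrightarrow> q \<noteq> 0 \<Longrightarrow>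
      \<exists>t\<ge>0. \<exists>\<Phi>\<in>S t. 0 < q \<bullet> \<Phi> y"
begin

definition F :: "real \<Rightarrow> real" where "F t = (SUP \<Phi>\<in>S t. e \<bullet> \<Phi> w)"

lemma K_scale: "x \<in> K \<Longrightarrow> 0 \<le> c \<Longrightarrow> c *\<^sub>R x \<in> K"
  using K_cone by (auto simp: cone_def)

lemma w_nonzero: "w \<noteq> 0"
proof
  assume "w = 0"
  then have "- z \<in> K" for z using w_unit[of z] by simp
  then have "z \<in> K \<inter> uminus ` K" for z by (metis IntI add.inverse_inverse image_eqI)
  then have "z = 0" for z :: 'a using K_pointed by auto
  then show False using nonzero_Basis SOME_Basis by blast
qed

lemma e_nonneg: "x \<in> K \<Longrightarrow> 0 \<le> e \<bullet> x"
  using e_ge[of x] a_pos by (meson less_imp_le mult_nonneg_nonneg norm_ge_zero order_trans)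

lemma e_nonzero: "e \<noteq> 0"
proof
  assume "e = 0"
  then have "a * norm w \<le> 0" using e_ge[OF w_mem] by simp
  then show False using a_pos w_nonzero by (simp add: mult_le_0_iff)
qed

lemma bdd_above_F: "0 \<le> t \<Longrightarrow> bdd_above ((\<lambda>\<Phi>. e \<bullet> \<Phi> w) ` S t)"
proof (rule bdd_aboveI2)
  fix \<Phi> assume "0 \<le> t" "\<Phi> \<in> S t"
  have "e \<bullet> \<Phi> w \<le> norm e * norm (\<Phi> w)" by (rule norm_cauchy_schwarz)
  also have "\<dots> \<le> norm e * (exp (M * t) * norm w)"
    by (intro mult_left_mono S_norm_le \<open>0 \<le> t\<close> \<open>\<Phi> \<in> S t\<close>) auto
  finally show "e \<bullet> \<Phi> w \<le> norm e * (exp (M * t) * norm w)" .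
qed

lemma le_F: "0 \<le> t \<Longrightarrow> \<Phi> \<in> S t \<Longrightarrow> e \<bullet> \<Phi> w \<le> F t"
  unfolding F_def by (rule cSUP_upper[OF _ bdd_above_F])

text \<open>The vector \<open>z\<close> may lie outside the cone: positivity of
  \<open>\<Phi>\<close> is applied to the gap between \<open>z\<close> and the multiple of
  \<open>w\<close> above it, so growth from \<open>w\<close> controls growth from every
  point.\<close>

lemma S_le_F:
  assumes "0 \<le> t" "\<Phi> \<in> S t"
  shows "e \<bullet> \<Phi> z \<le> \<kappa> * norm z * F t"
proof -
  interpret \<Phi>: linear \<Phi> by (rule S_linear[OF assms])
  have "0 \<le> e \<bullet> \<Phi> ((\<kappa> * norm z) *\<^sub>R w - z)" by (intro e_nonneg S_positive[OF assms] w_unit)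
  then have "e \<bullet> \<Phi> z \<le> \<kappa> * norm z * (e \<bullet> \<Phi> w)"
    by (simp add: \<Phi>.diff \<Phi>.scale inner_diff_right)
  also have "\<dots> \<le> \<kappa> * norm z * F t" using \<kappa>_pos by (intro mult_left_mono le_F assms) auto
  finally show ?thesis .
qed

lemma F_pos: "0 \<le> t \<Longrightarrow> 0 < F t"
proof -
  assume t: "0 \<le> t"
  then obtain \<Phi> where \<Phi>: "\<Phi> \<in> S t" using S_nonempty by blast
  have "0 < a * (exp (- M * t) * norm w)" using a_pos w_nonzero by simp
  also have "\<dots> \<le> a * norm (\<Phi> w)" using a_pos S_norm_ge[OF t \<Phi>] by (intro mult_left_mono) auto
  also have "\<dots> \<le> e \<bullet> \<Phi> w" by (intro e_ge S_positive[OF t \<Phi>] w_mem)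
  also have "\<dots> \<le> F t" by (rule le_F[OF t \<Phi>])
  finally show ?thesis .
qed

text \<open>For each pair of a dual unit vector and a unit vector of the cone, irreducibility
  supplies a time and a map with positive pairing, and the same map works for nearby pairs.
  Compactness of the set of pairs makes time and margin uniform.\<close>

lemma steering:
  obtains c T where "c > 0" "T \<ge> 0"
    "\<And>y q. y \<in> K \<Longrightarrow> (\<And>x. x \<in> K \<Longrightarrow> 0 \<le> q \<bullet> x) \<Longrightarrow>
       \<exists>t\<in>{0..T}. \<exists>\<Phi>\<in>S t. c * norm q * norm y \<le> q \<bullet> \<Phi> y"
proof -
  define Q where "Q = {q. \<forall>x\<in>K. 0 \<le> q \<bullet> x}"
  define D where "D = (Q \<inter> sphere 0 1) \<times> (K \<inter> sphere 0 1)"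
  \<comment> \<open>The single index bounds the time from above and the margin from below, so the
    sets increase with \<open>n\<close> and one index serves for a finite subcover.\<close>
  define U where "U n = {p. \<exists>t\<in>{0..real n}. \<exists>\<Phi>\<in>S t. 1 / real (Suc n) < fst p \<bullet> \<Phi> (snd p)}" for n
  have "Q = (\<Inter>x\<in>K. {q. 0 \<le> q \<bullet> x})" by (auto simp: Q_def)
  moreover have "closed (\<Inter>x\<in>K. {q. 0 \<le> q \<bullet> x})"
    by (intro closed_INT ballI closed_Collect_le continuous_intros)
  ultimately have "compact D" unfolding D_def
    by (intro compact_Times closed_Int_compact K_closed) auto
  moreover have "open (U n)" for n
  proof -
    have "U n = (\<Union>t\<in>{0..real n}. \<Union>\<Phi>\<in>S t. {p. 1 / real (Suc n) < fst p \<bullet> \<Phi> (snd p)})" by (auto simp: U_def)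
    moreover have "open {p. 1 / real (Suc n) < fst p \<bullet> \<Phi> (snd p)}" if "0 \<le> t" "\<Phi> \<in> S t" for t \<Phi>
    proof -
      have "bounded_linear \<Phi>" using S_linear[OF that] linear_conv_bounded_linear by blast
      then show ?thesis
        by (intro open_Collect_less continuous_intros bounded_linear.continuous_on[of \<Phi>])
    qed
    ultimately show ?thesis by (auto intro!: open_UN)
  qed
  moreover have "D \<subseteq> (\<Union>n\<in>UNIV. U n)"
  proof
    fix p assume p: "p \<in> D"
    then have "\<exists>t\<ge>0. \<exists>\<Phi>\<in>S t. 0 < fst p \<bullet> \<Phi> (snd p)"
      by (intro S_irreducible) (auto simp: D_def Q_def)
    then obtain t \<Phi> where t: "t \<ge> 0" "\<Phi> \<in> S t" "0 < fst p \<bullet> \<Phi> (snd p)" by blast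
    obtain n1 where n1: "t \<le> real n1" using real_arch_simple by blast
    obtain n2 where n2: "1 / real (Suc n2) < fst p \<bullet> \<Phi> (snd p)" using t(3) nat_approx_posE by metis
    have "1 / real (Suc (max n1 n2)) \<le> 1 / real (Suc n2)" by (intro divide_left_mono) auto
    then have "p \<in> U (max n1 n2)" using t n1 n2 by (auto simp: U_def intro!: bexI[of _ t] bexI[of _ \<Phi>])
    then show "p \<in> (\<Union>n\<in>UNIV. U n)" by blast
  qed
  ultimately obtain I where I: "finite I" "D \<subseteq> (\<Union>n\<in>I. U n)"
    by (rule compactE_image[of D UNIV U]) auto
  define N where "N = Max (insert 0 I)"
  have cover: "\<exists>t\<in>{0..real N}. \<exists>\<Phi>\<in>S t. 1 / real (Suc N) < fst p \<bullet> \<Phi> (snd p)" if p: "p \<in> D" for p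
  proof -
    obtain n where n: "n \<in> I" "p \<in> U n" using I p by blast
    then have "n \<le> N" using I(1) by (auto simp: N_def)
    moreover from n obtain t \<Phi> where "t \<in> {0..real n}" "\<Phi> \<in> S t" "1 / real (Suc n) < fst p \<bullet> \<Phi> (snd p)"
      by (auto simp: U_def)
    moreover have "1 / real (Suc N) \<le> 1 / real (Suc n)" using \<open>n \<le> N\<close> by (intro divide_left_mono) auto
    ultimately show ?thesis by (intro bexI[of _ t] bexI[of _ \<Phi>]) auto
  qed
  show ?thesis
  proof (rule that[of "1 / real (Suc N)" "real N"])
    fix y q assume y: "y \<in> K" and q: "\<And>x. x \<in> K \<Longrightarrow> 0 \<le> q \<bullet> x"
    show "\<exists>t\<in>{0..real N}. \<exists>\<Phi>\<in>S t. 1 / real (Suc N) * norm q * norm y \<le> q \<bullet> \<Phi> y"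
    proof (cases "q = 0 \<or> y = 0")
      case True
      obtain \<Phi> where "\<Phi> \<in> S 0" using S_nonempty[of 0] by auto
      moreover have "q \<bullet> \<Phi> y = 0" using True linear_0[OF S_linear[OF _ \<open>\<Phi> \<in> S 0\<close>]] by auto
      ultimately show ?thesis using True by (intro bexI[of _ 0] bexI[of _ \<Phi>]) auto
    next
      case False
      have "(q /\<^sub>R norm q, y /\<^sub>R norm y) \<in> D"
        using False y q by (auto simp: D_def Q_def intro!: K_scale mult_nonneg_nonneg)
      from cover[OF this] obtain t \<Phi> where t: "t \<in> {0..real N}" "\<Phi> \<in> S t"
          "1 / real (Suc N) < (q /\<^sub>R norm q) \<bullet> \<Phi> (y /\<^sub>R norm y)" by auto
      interpret \<Phi>: linear \<Phi> using S_linear t by auto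
      have "1 / real (Suc N) < (q \<bullet> \<Phi> y) / (norm q * norm y)"
        using t(3) by (simp add: \<Phi>.scale divide_inverse mult_ac)
      then have "1 / real (Suc N) * (norm q * norm y) < q \<bullet> \<Phi> y"
        using False by (subst (asm) pos_less_divide_eq) auto
      then show ?thesis using t by (intro bexI[of _ t] bexI[of _ \<Phi>]) (auto simp: mult.assoc)
    qed
  qed auto
qed

text \<open>A near-optimal \<open>\<Psi>\<close> for \<open>w\<close> defines the positive
  functional \<open>q\<close>, whose norm is at least a multiple of \<open>F s\<close>. Steering
  \<open>y\<close> to where \<open>q\<close> is large makes \<open>\<Psi>\<close> almost as
  effective from \<open>y\<close> as from \<open>w\<close>.\<close>

lemma uniform_growth:
  obtains c where "c > 0" "\<And>s y. 0 \<le> s \<Longrightarrow> y \<in> K \<Longrightarrow> \<exists>\<Phi>\<in>S s. c * F s * norm y \<le> e \<bullet> \<Phi> y"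
proof -
  obtain c0 T where c0: "c0 > 0" "T \<ge> 0" and steer: "\<And>y q. y \<in> K \<Longrightarrow> (\<And>x. x \<in> K \<Longrightarrow> 0 \<le> q \<bullet> x) \<Longrightarrow>
       \<exists>t\<in>{0..T}. \<exists>\<Phi>\<in>S t. c0 * norm q * norm y \<le> q \<bullet> \<Phi> y"
    by (rule steering) blast
  \<comment> \<open>The price of a final phase of length at most \<open>T\<close>: growth by at most
    \<open>exp (M * T)\<close>, and the passage from \<open>e\<close> to the norm and back.\<close>
  define B where "B = norm e * exp (M * T) / a"
  have B: "B > 0" using e_nonzero a_pos by (simp add: B_def)
  show ?thesis
  proof (rule that[of "c0 / (2 * norm w * B)"])
    show "c0 / (2 * norm w * B) > 0" using c0 w_nonzero B by simp
    fix s :: real and y assume s: "0 \<le> s" and y: "y \<in> K"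
    \<comment> \<open>The supremum need not be attained; settling for half of it produces the 2 in
      the constant.\<close>
    have "F s / 2 < F s" using F_pos[OF s] by simp
    then obtain \<Psi> where \<Psi>: "\<Psi> \<in> S s" "F s / 2 < e \<bullet> \<Psi> w"
      unfolding F_def using less_cSUP_iff[OF S_nonempty[OF s] bdd_above_F[OF s]] by blast
    define q where "q = adjoint \<Psi> e"
    have q: "q \<bullet> x = e \<bullet> \<Psi> x" for x
      using adjoint_works[OF S_linear[OF s \<Psi>(1)], of x e] by (simp add: q_def inner_commute)
    have "F s / 2 \<le> norm q * norm w" using \<Psi>(2) norm_cauchy_schwarz[of q w] by (simp add: q)
    then have qF: "F s / (2 * norm w) \<le> norm q" using w_nonzero by (simp add: field_simps)
    have "\<And>x. x \<in> K \<Longrightarrow> 0 \<le> q \<bullet> x" unfolding q by (intro e_nonneg S_positive[OF s \<Psi>(1)])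
    from steer[OF y this] obtain t \<Omega> where t: "t \<in> {0..T}" "\<Omega> \<in> S t" "c0 * norm q * norm y \<le> q \<bullet> \<Omega> y" by blast
    \<comment> \<open>Splitting the composition at time \<open>s\<close> instead of \<open>t\<close> moves the steering phase to the end, where it costs at most a constant factor.\<close>
    have "\<Psi> \<circ> \<Omega> \<in> S (s + t)" using S_comp[OF _ s t(2) \<Psi>(1)] t(1) by (simp add: add.commute)
    then obtain \<Phi> \<Omega>' where \<Phi>: "\<Phi> \<in> S s" "\<Omega>' \<in> S t" "\<Psi> \<circ> \<Omega> = \<Omega>' \<circ> \<Phi>"
      using S_split[OF s] t(1) by (metis atLeastAtMost_iff)
    have "c0 * (F s / (2 * norm w)) * norm y \<le> c0 * norm q * norm y"
      using c0 qF by (intro mult_right_mono mult_left_mono) auto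
    also have "\<dots> \<le> e \<bullet> (\<Psi> \<circ> \<Omega>) y" using t(3) by (simp add: q)
    also have "\<dots> \<le> norm e * norm (\<Omega>' (\<Phi> y))" unfolding \<Phi>(3) o_apply by (rule norm_cauchy_schwarz)
    also have "\<dots> \<le> norm e * (exp (M * t) * norm (\<Phi> y))"
      using t(1) by (intro mult_left_mono S_norm_le \<Phi>(2)) auto
    also have "\<dots> \<le> norm e * (exp (M * T) * norm (\<Phi> y))"
      using t(1) M_nonneg by (intro mult_left_mono mult_right_mono) (auto intro: mult_left_mono)
    also have "\<dots> = B * (a * norm (\<Phi> y))" using a_pos by (simp add: B_def)
    also have "\<dots> \<le> B * (e \<bullet> \<Phi> y)" using B by (intro mult_left_mono e_ge S_positive[OF s \<Phi>(1)] y) auto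
    finally have "c0 * (F s / (2 * norm w)) * norm y \<le> B * (e \<bullet> \<Phi> y)" .
    then have "c0 * (F s / (2 * norm w)) * norm y / B \<le> e \<bullet> \<Phi> y"
      unfolding pos_divide_le_eq[OF B] by (simp only: mult.commute)
    then have "c0 / (2 * norm w * B) * F s * norm y \<le> e \<bullet> \<Phi> y" by simp
    then show "\<exists>\<Phi>\<in>S s. c0 / (2 * norm w * B) * F s * norm y \<le> e \<bullet> \<Phi> y" using \<Phi>(1) by blast
  qed
qed

text \<open>The hypothesis makes every map of duration \<open>t0\<close> expand the cone by at most
  \<open>exp (\<alpha> * t0)\<close>. Splitting a long map into such pieces bounds it on the cone,
  and every vector is a difference of two vectors of the cone.\<close>

lemma exponential_bound_of_F:
  assumes t0: "0 < t0" and F: "\<kappa> / a * F t0 \<le> exp (\<alpha> * t0)"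
  shows "\<exists>C. \<forall>t\<ge>0. \<forall>\<Phi>\<in>S t. norm (\<Phi> x) \<le> C * exp (\<alpha> * t)"
proof -
  \<comment> \<open>\<open>L\<close> pays for the incomplete last period, of length
    \<open>r \<le> t0\<close>, with either sign of \<open>\<alpha>\<close>.\<close>
  define L where "L = exp ((\<bar>\<alpha>\<bar> + M) * t0)"
  have step: "norm (\<Phi> x) \<le> exp (\<alpha> * t0) * norm x" if "\<Phi> \<in> S t0" "x \<in> K" for \<Phi> x
  proof -
    have "a * norm (\<Phi> x) \<le> e \<bullet> \<Phi> x" using t0 that by (intro e_ge S_positive[OF _ that(1)]) auto
    also have "\<dots> \<le> \<kappa> * norm x * F t0" using t0 that by (intro S_le_F) auto
    finally have "norm (\<Phi> x) \<le> \<kappa> / a * F t0 * norm x" using a_pos by (simp add: field_simps)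
    also have "\<dots> \<le> exp (\<alpha> * t0) * norm x" using F by (intro mult_right_mono) auto
    finally show ?thesis .
  qed
  have iter: "norm (\<Phi> x) \<le> exp (\<alpha> * (real n * t0)) * (exp (M * r) * norm x)"
    if "\<Phi> \<in> S (real n * t0 + r)" "x \<in> K" "0 \<le> r" for n \<Phi> x r
    using that
  proof (induction n arbitrary: \<Phi> x)
    case 0
    then show ?case using S_norm_le by simp
  next
    case (Suc n)
    have "\<Phi> \<in> S (t0 + (real n * t0 + r))" using Suc.prems by (simp add: algebra_simps)
    then obtain \<Phi>1 \<Phi>2 where \<Phi>: "\<Phi>1 \<in> S t0" "\<Phi>2 \<in> S (real n * t0 + r)" "\<Phi> = \<Phi>2 \<circ> \<Phi>1"
      using S_split[of t0 "real n * t0 + r" \<Phi>] t0 Suc.prems by auto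
    have "norm (\<Phi> x) \<le> exp (\<alpha> * (real n * t0)) * (exp (M * r) * norm (\<Phi>1 x))"
      using Suc.IH[OF \<Phi>(2) S_positive[OF _ \<Phi>(1) Suc.prems(2)] Suc.prems(3)] t0 \<Phi>(3) by simp
    also have "\<dots> \<le> exp (\<alpha> * (real n * t0)) * (exp (M * r) * (exp (\<alpha> * t0) * norm x))"
      by (intro mult_left_mono step \<Phi>(1) Suc.prems) auto
    also have "\<dots> = exp (\<alpha> * (real (Suc n) * t0)) * (exp (M * r) * norm x)"
      by (simp add: algebra_simps exp_add)
    finally show ?case .
  qed
  have onK: "norm (\<Phi> x) \<le> L * norm x * exp (\<alpha> * t)" if "0 \<le> t" "\<Phi> \<in> S t" "x \<in> K" for t \<Phi> x
  proof -
    define n where "n = nat \<lfloor>t / t0\<rfloor>"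
    define r where "r = t - real n * t0"
    have n: "real n \<le> t / t0" "t / t0 < real n + 1" using that t0 by (auto simp: n_def)
    have r: "0 \<le> r" "r \<le> t0" using n t0 by (auto simp: r_def field_simps)
    have t: "t = real n * t0 + r" by (simp add: r_def)
    have "norm (\<Phi> x) \<le> exp (\<alpha> * (real n * t0)) * (exp (M * r) * norm x)"
      using iter that r t by metis
    also have "\<dots> = exp (- \<alpha> * r + M * r) * norm x * exp (\<alpha> * t)"
      unfolding t by (simp add: algebra_simps exp_add[symmetric])
    also have "\<dots> \<le> L * norm x * exp (\<alpha> * t)"
    proof (intro mult_right_mono)
      have "- \<alpha> * r + M * r = (- \<alpha> + M) * r" by (simp add: algebra_simps)
      also have "\<dots> \<le> (\<bar>\<alpha>\<bar> + M) * r" using r by (intro mult_right_mono) auto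
      also have "\<dots> \<le> (\<bar>\<alpha>\<bar> + M) * t0" using r M_nonneg by (intro mult_left_mono) auto
      finally show "exp (- \<alpha> * r + M * r) \<le> L" by (simp add: L_def)
    qed auto
    finally show ?thesis .
  qed
  define u where "u = (\<kappa> * norm x) *\<^sub>R w"
  have u: "u \<in> K" "u - x \<in> K" using \<kappa>_pos w_unit[of x] by (auto simp: u_def intro: K_scale w_mem)
  show ?thesis
  proof (intro exI[of _ "L * norm u + L * norm (u - x)"] allI impI ballI)
    fix t \<Phi> assume t: "(0::real) \<le> t" "\<Phi> \<in> S t"
    interpret \<Phi>: linear \<Phi> by (rule S_linear[OF t])
    have "\<Phi> x = \<Phi> u - \<Phi> (u - x)" by (simp add: \<Phi>.diff)
    then have "norm (\<Phi> x) \<le> norm (\<Phi> u) + norm (\<Phi> (u - x))" by (metis norm_triangle_ineq4)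
    also have "\<dots> \<le> L * norm u * exp (\<alpha> * t) + L * norm (u - x) * exp (\<alpha> * t)"
      by (intro add_mono onK t u)
    finally show "norm (\<Phi> x) \<le> (L * norm u + L * norm (u - x)) * exp (\<alpha> * t)" by (simp add: algebra_simps)
  qed
qed

end

section \<open>The norm as an upper limit of normalized growth\<close>

locale exponential_growth = positive_semigroup +
  fixes \<sigma> k1 k2 :: real
  assumes k1: "0 < k1" and F_ge: "\<And>t. 0 < t \<Longrightarrow> k1 * exp (\<sigma> * t) \<le> F t"
    and F_le: "\<And>t. 0 < t \<Longrightarrow> F t \<le> k2 * exp (\<sigma> * t)"
begin

text \<open>Suprema over tails of the time axis. The strict bound \<open>real n < t\<close> keeps
  the times positive even for \<open>n = 0\<close>, as the estimates for \<open>F\<close> require.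
  \<open>V n\<close> lives on the whole space, so that sublinearity and a Lipschitz bound hold there
  and not only on the cone.\<close>

definition V :: "nat \<Rightarrow> 'a \<Rightarrow> real" where
  "V n x = Sup {exp (- \<sigma> * t) * (e \<bullet> \<Phi> x) | t \<Phi>. real n < t \<and> \<Phi> \<in> S t}"

definition W :: "'a \<Rightarrow> real" where "W x = (INF n. V n x)"

text \<open>A common Lipschitz constant of all \<open>V n\<close> and of \<open>W\<close>:
  \<open>\<kappa>\<close> comes from the order unit, \<open>k2\<close> from the bound on
  \<open>F\<close>.\<close>

definition L :: real where "L = \<kappa> * k2"

lemma value_le:
  assumes "0 < t" "\<Phi> \<in> S t"
  shows "exp (- \<sigma> * t) * (e \<bullet> \<Phi> x) \<le> L * norm x"
proof -
  have "exp (- \<sigma> * t) * (e \<bullet> \<Phi> x) \<le> exp (- \<sigma> * t) * (\<kappa> * norm x * F t)"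
    using assms by (intro mult_left_mono S_le_F) auto
  also have "\<dots> \<le> exp (- \<sigma> * t) * (\<kappa> * norm x * (k2 * exp (\<sigma> * t)))"
    using assms \<kappa>_pos by (intro mult_left_mono F_le) auto
  also have "\<dots> = L * norm x" by (simp add: L_def exp_minus)
  finally show ?thesis .
qed

lemma value_ge:
  assumes "0 < t" "\<Phi> \<in> S t"
  shows "- L * norm x \<le> exp (- \<sigma> * t) * (e \<bullet> \<Phi> x)"
  using value_le[OF assms, of "- x"] linear_neg[OF S_linear[OF _ assms(2)], of x] assms(1) by simp

lemma V_upper:
  assumes "real n < t" "\<Phi> \<in> S t"
  shows "exp (- \<sigma> * t) * (e \<bullet> \<Phi> x) \<le> V n x"
  unfolding V_def
proof (rule cSup_upper)
  show "bdd_above {exp (- \<sigma> * t) * (e \<bullet> \<Phi> x) | t \<Phi>. real n < t \<and> \<Phi> \<in> S t}"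
    by (rule bdd_aboveI[of _ "L * norm x"]) (use value_le in force)
qed (use assms in blast)

lemma V_least:
  assumes "\<And>t \<Phi>. real n < t \<Longrightarrow> \<Phi> \<in> S t \<Longrightarrow> exp (- \<sigma> * t) * (e \<bullet> \<Phi> x) \<le> c"
  shows "V n x \<le> c"
  unfolding V_def
proof (rule cSup_least)
  obtain \<Phi> where "\<Phi> \<in> S (real n + 1)" using S_nonempty[of "real n + 1"] by auto
  then show "{exp (- \<sigma> * t) * (e \<bullet> \<Phi> x) | t \<Phi>. real n < t \<and> \<Phi> \<in> S t} \<noteq> {}" by force
qed (use assms in blast)

lemma V_approx:
  assumes "\<epsilon> > 0"
  obtains t \<Phi> where "real n < t" "\<Phi> \<in> S t" "V n x - \<epsilon> \<le> exp (- \<sigma> * t) * (e \<bullet> \<Phi> x)"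
proof -
  have "\<not> (\<forall>t \<Phi>. real n < t \<longrightarrow> \<Phi> \<in> S t \<longrightarrow> exp (- \<sigma> * t) * (e \<bullet> \<Phi> x) \<le> V n x - \<epsilon>)"
    using V_least[of n x "V n x - \<epsilon>"] assms by force
  with that show ?thesis by (meson linear)
qed

lemma V_le: "V n x \<le> L * norm x"
  by (rule V_least, rule value_le) auto

lemma V_ge: "- L * norm x \<le> V n x"
proof -
  obtain \<Phi> where \<Phi>: "\<Phi> \<in> S (real n + 1)" using S_nonempty[of "real n + 1"] by auto
  have "- L * norm x \<le> exp (- \<sigma> * (real n + 1)) * (e \<bullet> \<Phi> x)" by (rule value_ge[OF _ \<Phi>]) simp
  also have "\<dots> \<le> V n x" by (rule V_upper[OF _ \<Phi>]) simp
  finally show ?thesis .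
qed

lemma V_add: "V n (x + y) \<le> V n x + V n y"
proof (rule V_least)
  fix t \<Phi> assume t: "real n < t" "\<Phi> \<in> S t"
  have "\<Phi> (x + y) = \<Phi> x + \<Phi> y" using t by (intro linear_add S_linear[of t]) auto
  then show "exp (- \<sigma> * t) * (e \<bullet> \<Phi> (x + y)) \<le> V n x + V n y"
    using V_upper[OF t, of x] V_upper[OF t, of y] by (simp add: inner_add_right distrib_left)
qed

lemma V_scale: "0 \<le> c \<Longrightarrow> V n (c *\<^sub>R x) \<le> c * V n x"
proof (rule V_least)
  fix t \<Phi> assume c: "0 \<le> c" and t: "real n < t" "\<Phi> \<in> S t"
  have "\<Phi> (c *\<^sub>R x) = c *\<^sub>R \<Phi> x" using t by (intro linear_scale S_linear[of t]) auto
  then show "exp (- \<sigma> * t) * (e \<bullet> \<Phi> (c *\<^sub>R x)) \<le> c * V n x"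
    using mult_left_mono[OF V_upper[OF t, of x] c] by (simp add: mult_ac)
qed

lemma V_lipschitz: "V n x \<le> V n y + L * norm (x - y)"
  using V_add[of n y "x - y"] V_le[of n "x - y"] by simp

lemma V_mono: "x - y \<in> K \<Longrightarrow> V n y \<le> V n x"
proof (rule V_least)
  fix t \<Phi> assume xy: "x - y \<in> K" and t: "real n < t" "\<Phi> \<in> S t"
  have t0: "0 \<le> t" using t by simp
  have "0 \<le> e \<bullet> \<Phi> (x - y)" by (intro e_nonneg S_positive[OF t0 t(2)] xy)
  then have "e \<bullet> \<Phi> y \<le> e \<bullet> \<Phi> x"
    by (simp add: linear_diff[OF S_linear[OF t0 t(2)]] inner_diff_right)
  then have "exp (- \<sigma> * t) * (e \<bullet> \<Phi> y) \<le> exp (- \<sigma> * t) * (e \<bullet> \<Phi> x)" by (intro mult_left_mono) auto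
  also have "\<dots> \<le> V n x" by (rule V_upper[OF t])
  finally show "exp (- \<sigma> * t) * (e \<bullet> \<Phi> y) \<le> V n x" .
qed

lemma V_antimono: "m \<le> n \<Longrightarrow> V n x \<le> V m x"
  by (rule V_least, rule V_upper) auto

lemma V_flow:
  assumes "0 \<le> r" "\<Phi> \<in> S r"
  shows "V n (\<Phi> x) \<le> exp (\<sigma> * r) * V n x"
proof (rule V_least)
  fix t \<Psi> assume t: "real n < t" "\<Psi> \<in> S t"
  have "exp (- \<sigma> * (r + t)) * (e \<bullet> (\<Psi> \<circ> \<Phi>) x) \<le> V n x"
    using t assms by (intro V_upper S_comp) auto
  then have "exp (\<sigma> * r) * (exp (- \<sigma> * (r + t)) * (e \<bullet> (\<Psi> \<circ> \<Phi>) x)) \<le> exp (\<sigma> * r) * V n x"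
    by (intro mult_left_mono) auto
  also have "exp (\<sigma> * r) * (exp (- \<sigma> * (r + t)) * (e \<bullet> (\<Psi> \<circ> \<Phi>) x)) = exp (- \<sigma> * t) * (e \<bullet> \<Psi> (\<Phi> x))"
    by (simp add: mult.assoc[symmetric] exp_add[symmetric] algebra_simps)
  finally show "exp (- \<sigma> * t) * (e \<bullet> \<Psi> (\<Phi> x)) \<le> exp (\<sigma> * r) * V n x" .
qed

lemma bdd_below_V: "bdd_below (range (\<lambda>n. V n x))"
  using V_ge by (intro bdd_belowI2)

lemma W_le_V: "W x \<le> V n x"
  unfolding W_def by (rule cINF_lower[OF bdd_below_V]) simp

lemma W_greatest: "(\<And>n. c \<le> V n x) \<Longrightarrow> c \<le> W x"
  unfolding W_def by (rule cINF_greatest) auto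

text \<open>A map that is nearly optimal for \<open>V (Suc n)\<close> acts for a time
  \<open>t > n + 1\<close>. After its first unit of time the remainder still acts longer than
  \<open>n\<close>, hence competes in \<open>V n\<close>. The loss of one index disappears in the
  limit; this is the reason for using tails.\<close>

lemma V_near_invariant:
  assumes "\<epsilon> > 0"
  obtains \<Phi> where "\<Phi> \<in> S 1" "exp \<sigma> * (W x - \<epsilon>) \<le> V n (\<Phi> x)"
proof -
  obtain t \<Psi> where t: "real (Suc n) < t" "\<Psi> \<in> S t" "V (Suc n) x - \<epsilon> \<le> exp (- \<sigma> * t) * (e \<bullet> \<Psi> x)"
    using V_approx[OF assms, of "Suc n" x] .
  have "\<Psi> \<in> S (1 + (t - 1))" using t by simp
  moreover have "0 \<le> t - 1" using t by simp
  ultimately obtain \<Phi> \<Omega> where \<Phi>: "\<Phi> \<in> S 1" "\<Omega> \<in> S (t - 1)" "\<Psi> = \<Omega> \<circ> \<Phi>"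
    using S_split[of 1 "t - 1" \<Psi>] by auto
  have "exp \<sigma> * (W x - \<epsilon>) \<le> exp \<sigma> * (exp (- \<sigma> * t) * (e \<bullet> \<Psi> x))"
    using W_le_V[of x "Suc n"] t by (intro mult_left_mono) auto
  also have "\<dots> = exp (- \<sigma> * (t - 1)) * (e \<bullet> \<Omega> (\<Phi> x))"
    by (simp add: \<Phi>(3) mult.assoc[symmetric] exp_add[symmetric] algebra_simps)
  also have "\<dots> \<le> V n (\<Phi> x)" using t by (intro V_upper \<Phi>(2)) auto
  finally show ?thesis using that \<Phi>(1) by blast
qed

lemma W_add: "W (x + y) \<le> W x + W y"
proof -
  have le: "W (x + y) \<le> V n x + V m y" for n m
  proof -
    have "W (x + y) \<le> V (max n m) (x + y)" by (rule W_le_V)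
    also have "\<dots> \<le> V (max n m) x + V (max n m) y" by (rule V_add)
    also have "\<dots> \<le> V n x + V m y" by (intro add_mono V_antimono) auto
    finally show ?thesis .
  qed
  have "W (x + y) - V n x \<le> W y" for n using le[of n] by (intro W_greatest) (simp add: diff_le_eq add.commute)
  then have "W (x + y) - W y \<le> V n x" for n by (simp add: algebra_simps)
  then have "W (x + y) - W y \<le> W x" by (rule W_greatest)
  then show ?thesis by simp
qed

lemma W_0: "W 0 = 0"
  using V_le[of _ 0] V_ge[of 0] by (intro antisym W_greatest order_trans[OF W_le_V, of 0 0]) simp_all

lemma W_scale:
  assumes "0 \<le> c"
  shows "W (c *\<^sub>R x) = c * W x"
proof (cases "c = 0")
  case False
  have le: "W (c *\<^sub>R x) \<le> c * W x" if "0 < c" for c x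
  proof -
    have "W (c *\<^sub>R x) / c \<le> W x"
    proof (rule W_greatest)
      fix n
      have "W (c *\<^sub>R x) \<le> c * V n x" using W_le_V V_scale that by (meson less_imp_le order_trans)
      then show "W (c *\<^sub>R x) / c \<le> V n x" using that by (simp add: field_simps)
    qed
    then show ?thesis using that by (simp add: field_simps)
  qed
  have "W ((1 / c) *\<^sub>R (c *\<^sub>R x)) \<le> 1 / c * W (c *\<^sub>R x)" using False assms by (intro le) auto
  then have "c * W x \<le> W (c *\<^sub>R x)" using False assms by (simp add: field_simps)
  with le[of c x] False assms show ?thesis by simp
qed (simp add: W_0)

text \<open>From each point of the cone, uniform growth provides maps of arbitrarily long duration
  that realize a fixed fraction of \<open>F t\<close>, which is of exponential size at least. Here
  irreducibility enters the positivity of the norm.\<close>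

lemma W_lower:
  obtains k where "0 < k" "\<And>x. x \<in> K \<Longrightarrow> k * norm x \<le> W x"
proof -
  obtain c where c: "c > 0" "\<And>s y. 0 \<le> s \<Longrightarrow> y \<in> K \<Longrightarrow> \<exists>\<Phi>\<in>S s. c * F s * norm y \<le> e \<bullet> \<Phi> y"
    by (rule uniform_growth) blast
  show ?thesis
  proof (rule that[of "c * k1"])
    fix x assume x: "x \<in> K"
    show "c * k1 * norm x \<le> W x"
    proof (rule W_greatest)
      fix n
      define t where "t = real n + 1"
      obtain \<Phi> where \<Phi>: "\<Phi> \<in> S t" "c * F t * norm x \<le> e \<bullet> \<Phi> x" using c(2)[OF _ x, of t] by (auto simp: t_def)
      have "c * k1 * norm x = exp (- \<sigma> * t) * (c * (k1 * exp (\<sigma> * t)) * norm x)" by (simp add: exp_minus)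
      also have "\<dots> \<le> exp (- \<sigma> * t) * (c * F t * norm x)"
        using c(1) F_ge[of t] by (intro mult_left_mono mult_right_mono) (auto simp: t_def)
      also have "\<dots> \<le> exp (- \<sigma> * t) * (e \<bullet> \<Phi> x)" using \<Phi>(2) by (intro mult_left_mono) auto
      also have "\<dots> \<le> V n x" by (intro V_upper \<Phi>(1)) (simp add: t_def)
      finally show "c * k1 * norm x \<le> V n x" .
    qed
  qed (use c k1 in auto)
qed

lemma W_mono: "x - y \<in> K \<Longrightarrow> W y \<le> W x"
  using V_mono W_le_V by (intro W_greatest) (blast intro: order_trans)

lemma W_flow:
  assumes "0 \<le> r" "\<Phi> \<in> S r"
  shows "W (\<Phi> x) \<le> exp (\<sigma> * r) * W x"
proof -
  have "exp (- \<sigma> * r) * W (\<Phi> x) \<le> W x"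
  proof (rule W_greatest)
    fix n
    have "W (\<Phi> x) \<le> exp (\<sigma> * r) * V n x" using W_le_V V_flow[OF assms] order_trans by blast
    then show "exp (- \<sigma> * r) * W (\<Phi> x) \<le> V n x" by (simp add: exp_minus field_simps)
  qed
  then show ?thesis by (simp add: exp_minus field_simps)
qed

lemma W_lipschitz: "W x \<le> W y + L * norm (x - y)"
  using W_add[of y "x - y"] order_trans[OF W_le_V V_le, of "x - y"] by simp

end

section \<open>Irreducible families of Metzler operators\<close>

lemma tendsto_of_one_sided_lipschitz:
  fixes f :: "'a::real_normed_vector \<Rightarrow> real"
  assumes f: "\<And>x y. f x \<le> f y + L * norm (x - y)" and y: "(y \<longlongrightarrow> x) \<F>"
  shows "((\<lambda>n. f (y n)) \<longlongrightarrow> f x) \<F>"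
proof -
  have "((\<lambda>n. L * norm (y n - x)) \<longlongrightarrow> L * norm (x - x)) \<F>"
    by (intro tendsto_intros y)
  then have lim: "((\<lambda>n. L * norm (y n - x)) \<longlongrightarrow> 0) \<F>" by simp
  have "norm (f (y n) - f x) \<le> L * norm (y n - x)" for n
    using f[of "y n" x] f[of x "y n"] unfolding norm_minus_commute[of x] real_norm_def by linarith
  then have "((\<lambda>n. f (y n) - f x) \<longlongrightarrow> 0) \<F>"
    by (intro Lim_null_comparison[OF always_eventually lim] allI)
  then show ?thesis by (rule Lim_null[THEN iffD2])
qed

text \<open>A control on the half-line is extended to negative times by the constant
  \<open>A 0\<close>, which belongs to the family.\<close>

lemma trajectory_iff_control:
  "trajectory \<B> x \<longleftrightarrow> (\<exists>A. control \<B> A \<and> ode_solution A x)"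
proof
  assume "trajectory \<B> x"
  then obtain A where A: "A \<in> borel_measurable (lebesgue_on {0..})" "\<And>t. t \<ge> 0 \<Longrightarrow> A t \<in> \<B>" "ode_solution A x"
    by (auto simp: trajectory_def)
  define A' where "A' t = (if 0 \<le> t then A t else A 0)" for t :: real
  have "A' \<in> borel_measurable lebesgue"
    unfolding A'_def using A(1)
    by (subst measurable_If_restrict_space_iff) (auto simp: atLeast_def)
  then have "control \<B> A'" using A(2) by (auto simp: control_def A'_def)
  moreover have "ode_solution A' x" unfolding ode_solution_def
  proof (intro allI impI conjI)
    fix t :: real assume t: "0 \<le> t"
    have eq: "A' s *v x s = A s *v x s" if "s \<in> {0..t}" for s using that by (simp add: A'_def)
    have ai: "(\<lambda>s. A s *v x s) absolutely_integrable_on {0..t}"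
      and xt: "x t = x 0 + integral {0..t} (\<lambda>s. A s *v x s)"
      using A(3) t unfolding ode_solution_def by blast+
    show "(\<lambda>s. A' s *v x s) absolutely_integrable_on {0..t}"
      by (rule absolutely_integrable_spike[OF ai negligible_empty]) (use eq in auto)
    have "integral {0..t} (\<lambda>s. A' s *v x s) = integral {0..t} (\<lambda>s. A s *v x s)"
      by (rule integral_cong) (rule eq)
    then show "x t = x 0 + integral {0..t} (\<lambda>s. A' s *v x s)" by (simp only:) (rule xt)
  qed
  ultimately show "\<exists>A. control \<B> A \<and> ode_solution A x" by blast
next
  assume "\<exists>A. control \<B> A \<and> ode_solution A x"
  then show "trajectory \<B> x"
    unfolding trajectory_def control_def by (auto intro: measurable_restrict_space1)
qed

section \<open>Irreducibility carried over from the family to its flow\<close>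

lemma (in bounded_operators) matrix_maps_into_span_of_flow:
  assumes A: "A \<in> \<B>" and inv: "\<And>t. 0 \<le> t \<Longrightarrow> flow (\<lambda>_. A) x t \<in> span F"
  shows "A *v x \<in> span F"
proof -
  \<comment> \<open>For the singleton family the mean operator of a step can only be
    \<open>A\<close> itself, so the difference quotients of the flow converge to
    \<open>A *v x\<close>.\<close>
  interpret A: bounded_operators "{A}" M by standard (use M_bound M_nonneg A in auto)
  have c: "control {A} (\<lambda>_. A)" by (auto simp: control_def)
  define y where "y = flow (\<lambda>_. A) x"
  have y: "solves_on 1 (\<lambda>_. A) y" unfolding y_def by (rule A.flow_solves_on[OF c])
  have y0: "y 0 = x" by (simp add: y_def A.flow_0[OF c])
  obtain R where R: "\<And>s. s \<in> {0..1} \<Longrightarrow> norm (y s) \<le> R" using A.solves_on_bounded[OF y] by blast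
  define h where "h n = 1 / real (Suc n)" for n
  have h: "0 < h n" "h n \<le> 1" for n by (auto simp: h_def)
  have bound: "norm ((1 / h n) *\<^sub>R (y (h n) - x) - A *v x) \<le> M\<^sup>2 * R * h n" for n
  proof -
    have b: "norm (y (h n) - x - h n *\<^sub>R (A *v x)) \<le> M\<^sup>2 * R * (h n)\<^sup>2"
      using A.solves_on_step[OF c y R, of "{A}" 0 "h n"] h[of n] y0 by auto
    have "(1 / h n) *\<^sub>R (y (h n) - x) - A *v x = (1 / h n) *\<^sub>R (y (h n) - x - h n *\<^sub>R (A *v x))"
      using h(1)[of n] by (simp add: scaleR_diff_right)
    then have "norm ((1 / h n) *\<^sub>R (y (h n) - x) - A *v x) = 1 / h n * norm (y (h n) - x - h n *\<^sub>R (A *v x))"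
      using h(1)[of n] by simp
    also have "\<dots> \<le> 1 / h n * (M\<^sup>2 * R * (h n)\<^sup>2)" using b h(1)[of n] by (intro mult_left_mono) auto
    also have "\<dots> = M\<^sup>2 * R * h n" using h(1)[of n] by (simp add: power2_eq_square)
    finally show ?thesis .
  qed
  have "(\<lambda>n. M\<^sup>2 * R * h n) \<longlonglongrightarrow> M\<^sup>2 * R * 0"
    unfolding h_def by (intro tendsto_intros LIMSEQ_Suc[OF lim_const_over_n])
  then have "(\<lambda>n. M\<^sup>2 * R * h n) \<longlonglongrightarrow> 0" by simp
  from Lim_null_comparison[OF always_eventually[OF allI[OF bound]] this]
  have "(\<lambda>n. (1 / h n) *\<^sub>R (y (h n) - x) - A *v x) \<longlonglongrightarrow> 0" .
  then have lim: "(\<lambda>n. (1 / h n) *\<^sub>R (y (h n) - x)) \<longlonglongrightarrow> A *v x" by (rule Lim_null[THEN iffD2])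
  have "x \<in> span F" using inv[of 0] y0 by (simp add: y_def)
  then have "(1 / h n) *\<^sub>R (y (h n) - x) \<in> span F" for n
    using inv[of "h n"] h(1)[of n] by (auto simp: y_def intro!: span_scale span_diff)
  from closed_sequentially[OF closed_span this lim] show ?thesis .
qed

lemma (in bounded_operators) flow_irreducible:
  fixes K :: "(real^'d) set"
  assumes K: "proper_cone K" and B: "compact \<B>" "\<B> \<noteq> {}" "\<forall>A\<in>\<B>. metzler K A" "cone_irreducible K \<B>"
    and y: "y \<in> K" "y \<noteq> 0" and q: "\<And>x. x \<in> K \<Longrightarrow> 0 \<le> q \<bullet> x" "q \<noteq> 0"
  shows "\<exists>t\<ge>0. \<exists>\<Phi>\<in>flow_maps \<B> t. 0 < q \<bullet> \<Phi> y"
proof (rule ccontr)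
  assume contra: "\<not> ?thesis"
  have cK: "cone K" "convex K" "closed K" "interior K \<noteq> {}" using K by (auto simp: proper_cone_def)
  then have Kne: "K \<noteq> {}" by auto
  have pos: "\<Phi> x \<in> K" if "\<Phi> \<in> flow_maps \<B> t" "0 \<le> t" "x \<in> K" for \<Phi> t x
  proof -
    obtain A where A: "control \<B> A" "\<Phi> = (\<lambda>v. flow A v t)" using \<open>\<Phi> \<in> _\<close> by (auto simp: flow_maps_def)
    show ?thesis unfolding A(2)
      by (rule solves_on_in_cone[OF A(1) flow_solves_on[OF A(1)] _ cK(1-3) Kne B(1,3)])
        (use that in \<open>auto simp: flow_0[OF A(1)]\<close>)
  qed
  define P where "P = {p. (\<forall>x\<in>K. 0 \<le> p \<bullet> x) \<and> (\<forall>t\<ge>0. \<forall>\<Phi>\<in>flow_maps \<B> t. p \<bullet> \<Phi> y = 0)}"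
  have qP: "q \<in> P" unfolding P_def
    using contra q(1) pos y(1) by (auto simp: not_less intro!: antisym)
  have "convex P"
    by (rule convexI) (auto simp: P_def inner_add_left)
  then have "rel_interior P \<noteq> {}" using qP rel_interior_eq_empty by blast
  then obtain p0 where p0: "p0 \<in> rel_interior P" by blast
  then have p0P: "p0 \<in> P" using rel_interior_subset by blast
  \<comment> \<open>As \<open>p0\<close> is a relative interior point, the segment from
    \<open>p\<close> to \<open>p0\<close> can be prolonged beyond \<open>p0\<close> within
    \<open>P\<close>. At a zero of \<open>p0\<close> in the cone this forces \<open>p\<close> to be
    nonpositive, hence zero: the face of \<open>p0\<close> is the smallest one cut out by a member
    of \<open>P\<close>.\<close>
  have perp: "p \<bullet> x = 0" if p: "p \<in> P" and x: "x \<in> K" "p0 \<bullet> x = 0" for p x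
  proof -
    obtain e where e: "e > 1" "(1 - e) *\<^sub>R p + e *\<^sub>R p0 \<in> P"
      using p0 convex_rel_interior_iff[OF \<open>convex P\<close>] p by blast
    then have "0 \<le> ((1 - e) *\<^sub>R p + e *\<^sub>R p0) \<bullet> x" using x by (auto simp: P_def)
    then have "0 \<le> (1 - e) * (p \<bullet> x)" using x(2) by (simp add: inner_add_left)
    then have "p \<bullet> x \<le> 0" using e(1) by (simp add: zero_le_mult_iff)
    moreover have "0 \<le> p \<bullet> x" using p x by (auto simp: P_def)
    ultimately show ?thesis by simp
  qed
  \<comment> \<open>Otherwise every member of \<open>P\<close>, in particular \<open>q\<close>,
    would vanish on the whole solid cone.\<close>
  have "p0 \<noteq> 0"
  proof
    assume "p0 = 0"
    then have q0: "q \<bullet> x = 0" if "x \<in> K" for x using perp[OF qP that] by simp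
    obtain w \<kappa> where w: "w \<in> K" "\<kappa> > 0" "\<And>z. (\<kappa> * norm z) *\<^sub>R w - z \<in> K"
      by (rule solid_cone_order_unit[OF cK(1,4)]) (rule that)
    then have "q \<bullet> q = 0" using q0[OF w(1)] q0[OF w(3)[of q]] by (simp add: inner_diff_right)
    then show False using q(2) by simp
  qed
  define F where "F = K \<inter> {x. p0 \<bullet> x = 0}"
  have face: "cone_face K F" unfolding cone_face_def F_def
    using \<open>p0 \<noteq> 0\<close> p0P by (auto simp: P_def)
  have cst: "control \<B> (\<lambda>_. A)" if "A \<in> \<B>" for A using that by (auto simp: control_def)
  obtain A0 where A0: "A0 \<in> \<B>" using B(2) by blast
  have id: "(\<lambda>v. flow (\<lambda>_. A0) v 0) \<in> flow_maps \<B> 0" using cst[OF A0] by (auto simp: flow_maps_def)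
  have p0_orbit: "p0 \<bullet> \<Phi> y = 0" if "0 \<le> t" "\<Phi> \<in> flow_maps \<B> t" for \<Phi> t
    using p0P that by (auto simp: P_def)
  \<comment> \<open>Time 0 puts \<open>y\<close> itself into the face, which is therefore
    nontrivial.\<close>
  from p0_orbit[OF order_refl id] have "p0 \<bullet> y = 0" by (simp add: flow_0[OF cst[OF A0]])
  then have "y \<in> F" using y by (simp add: F_def)
  then have nontriv: "nontrivial_face_plane K (span F)"
    using face y(2) unfolding nontrivial_face_plane_def by blast
  have inv: "\<Phi> x \<in> F" if \<Phi>: "\<Phi> \<in> flow_maps \<B> t" "0 \<le> t" and x: "x \<in> F" for \<Phi> t x
  proof -
    have lin: "linear \<Phi>" using \<Phi> linear_flow by (auto simp: flow_maps_def)
    have adj: "adjoint \<Phi> p0 \<bullet> u = p0 \<bullet> \<Phi> u" for u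
      using adjoint_works[OF lin, of u p0] by (simp add: inner_commute)
    \<comment> \<open>\<open>\<Phi>\<close> after any map of the semigroup is again in the
      semigroup, so the adjoint sends \<open>p0\<close> into \<open>P\<close>, and
      \<open>perp\<close> applies to the image.\<close>
    have "adjoint \<Phi> p0 \<in> P" unfolding P_def mem_Collect_eq adj
    proof (intro conjI ballI allI impI)
      show "0 \<le> p0 \<bullet> \<Phi> u" if "u \<in> K" for u using p0P pos[OF \<Phi> that] by (simp add: P_def)
      show "p0 \<bullet> \<Phi> (\<Psi> y) = 0" if "0 \<le> s" "\<Psi> \<in> flow_maps \<B> s" for s \<Psi>
      proof -
        have "\<Phi> \<circ> \<Psi> \<in> flow_maps \<B> (s + t)" by (rule flow_maps_comp[OF that(2) \<Phi>(1) that(1) \<Phi>(2)])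
        from p0_orbit[OF _ this] that(1) \<Phi>(2) show ?thesis by simp
      qed
    qed
    from perp[OF this, of x] x have "p0 \<bullet> \<Phi> x = 0" by (simp add: F_def adj)
    then show ?thesis using pos[OF \<Phi>] x by (simp add: F_def)
  qed
  have "(\<lambda>v. A *v v) ` span F \<subseteq> span F" if A: "A \<in> \<B>" for A
  proof -
    have "A *v x \<in> span F" if x: "x \<in> F" for x
    proof (rule matrix_maps_into_span_of_flow[OF A])
      fix t :: real assume t: "0 \<le> t"
      have "(\<lambda>v. flow (\<lambda>_. A) v t) \<in> flow_maps \<B> t" using cst[OF A] by (auto simp: flow_maps_def)
      from inv[OF this t x] show "flow (\<lambda>_. A) x t \<in> span F" by (rule span_base)
    qed
    then have "F \<subseteq> {v. A *v v \<in> span F}" by blast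
    moreover have "subspace {v. A *v v \<in> span F}"
      by (rule subspaceI)
        (auto simp: matrix_vector_right_distrib matrix_vector_mult_scaleR span_zero intro: span_add span_scale)
    ultimately have "span F \<subseteq> {v. A *v v \<in> span F}" by (rule span_minimal)
    then show ?thesis by blast
  qed
  with nontriv B(4) show False unfolding cone_irreducible_def by blast
qed

lemma compact_imp_bounded_operators:
  fixes \<A> :: "(real^'d^'d) set"
  assumes "compact \<A>"
  obtains M where "bounded_operators \<A> M"
proof -
  obtain C where C: "0 < C" "\<And>(A :: real^'d^'d) x. norm (A *v x) \<le> norm A * norm x * C"
    using bounded_bilinear.pos_bounded[OF bounded_bilinear_matrix_vector_mult] by blast
  obtain R where R: "0 < R" "\<And>A. A \<in> \<A> \<Longrightarrow> norm A \<le> R"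
    using compact_imp_bounded[OF assms] by (auto simp: bounded_pos)
  have "bounded_operators \<A> (R * C)"
  proof
    show "norm (A *v x) \<le> R * C * norm x" if "A \<in> \<A>" for A x
    proof -
      have "norm (A *v x) \<le> norm A * norm x * C" by (rule C)
      also have "\<dots> \<le> R * norm x * C" using R(2)[OF that] C(1) by (intro mult_right_mono) auto
      finally show ?thesis by (simp add: mult_ac)
    qed
  qed (use R C compact_imp_bounded[OF assms] in auto)
  with that show ?thesis .
qed

locale irreducible_metzler_family = bounded_operators \<B> M for \<B> :: "(real^'d^'d) set" and M +
  fixes K :: "(real^'d) set" and e w :: "real^'d" and a \<kappa> :: real
  assumes proper: "proper_cone K" and compact: "compact \<B>" and nonempty: "\<B> \<noteq> {}"
    and metzler: "\<forall>A\<in>\<B>. metzler K A" and irreducible: "cone_irreducible K \<B>"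
    and a_gt_0: "a > 0" and e_lower: "\<And>x. x \<in> K \<Longrightarrow> a * norm x \<le> e \<bullet> x"
    and w_in: "w \<in> K" and \<kappa>_gt_0: "\<kappa> > 0" and order_unit: "\<And>z. (\<kappa> * norm z) *\<^sub>R w - z \<in> K"
begin

lemma flow_in_cone:
  assumes "control \<B> A" "0 \<le> t" "x \<in> K"
  shows "flow A x t \<in> K"
proof -
  have "cone K" "convex K" "closed K" "K \<noteq> {}" using proper by (auto simp: proper_cone_def)
  from solves_on_in_cone[OF assms(1) flow_solves_on[OF assms(1)] assms(2) this compact metzler]
  show ?thesis using assms by (simp add: flow_0)
qed

sublocale positive_semigroup K "flow_maps \<B>" M e w a \<kappa>
proof (rule positive_semigroup.intro)
  show "cone K" "convex K" "closed K" "K \<inter> uminus ` K = {0}" using proper by (auto simp: proper_cone_def)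
  show "linear \<Phi>" if "0 \<le> t" "\<Phi> \<in> flow_maps \<B> t" for \<Phi> t
    using that linear_flow by (auto simp: flow_maps_def)
  show "\<Phi> x \<in> K" if "0 \<le> t" "\<Phi> \<in> flow_maps \<B> t" "x \<in> K" for \<Phi> t x
    using that flow_in_cone by (auto simp: flow_maps_def)
  show "norm (\<Phi> x) \<le> exp (M * t) * norm x" if "0 \<le> t" "\<Phi> \<in> flow_maps \<B> t" for \<Phi> t x
    using that flow_norm_le by (auto simp: flow_maps_def)
  show "exp (- M * t) * norm x \<le> norm (\<Phi> x)" if "0 \<le> t" "\<Phi> \<in> flow_maps \<B> t" for \<Phi> t x
    using that flow_norm_ge unfolding flow_maps_def by blast
  show "flow_maps \<B> t \<noteq> {}" for t
  proof -
    obtain A where "A \<in> \<B>" using nonempty by blast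
    then have "control \<B> (\<lambda>_. A)" by (auto simp: control_def)
    then show ?thesis by (auto simp: flow_maps_def)
  qed
  show "\<exists>t\<ge>0. \<exists>\<Phi>\<in>flow_maps \<B> t. 0 < q \<bullet> \<Phi> y"
    if "y \<in> K" "y \<noteq> 0" "\<And>x. x \<in> K \<Longrightarrow> 0 \<le> q \<bullet> x" "q \<noteq> 0" for y q
    by (rule flow_irreducible[OF proper compact nonempty metzler irreducible that])
qed (fact a_gt_0 e_lower w_in \<kappa>_gt_0 order_unit M_nonneg flow_maps_comp flow_maps_split | use flow_maps_comp flow_maps_split in blast)+

section \<open>Maximal growth and the Lyapunov exponent\<close>

abbreviation growth_rates :: "real set" where
  "growth_rates \<equiv> {\<alpha>. \<forall>x. trajectory \<B> x \<longrightarrow> (\<exists>C. \<forall>t\<ge>0. norm (x t) \<le> C * exp (\<alpha> * t))}"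

lemma growth_rateI:
  assumes "0 < t0" and "\<kappa> / a * F t0 \<le> exp (\<alpha> * t0)"
  shows "\<alpha> \<in> growth_rates"
proof (intro CollectI allI impI)
  fix x assume "trajectory \<B> x"
  then obtain A where A: "control \<B> A" "ode_solution A x" using trajectory_iff_control by blast
  obtain C where C: "\<And>t \<Phi>. 0 \<le> t \<Longrightarrow> \<Phi> \<in> flow_maps \<B> t \<Longrightarrow> norm (\<Phi> (x 0)) \<le> C * exp (\<alpha> * t)"
    using exponential_bound_of_F[OF assms, of "x 0"] by blast
  have "norm (x t) \<le> C * exp (\<alpha> * t)" if t: "0 \<le> t" for t
  proof -
    have "(\<lambda>v. flow A v t) \<in> flow_maps \<B> t" using A(1) by (auto simp: flow_maps_def)
    from C[OF t this] show ?thesis using ode_solution_eq_flow[OF A t] by simp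
  qed
  then show "\<exists>C. \<forall>t\<ge>0. norm (x t) \<le> C * exp (\<alpha> * t)" by blast
qed

text \<open>By uniform growth, near-optimal maps at time \<open>T\<close> can be concatenated into a single trajectory that grows by a factor comparable to \<open>F T\<close> in each period.\<close>

lemma F_le_growth_rate:
  obtains c where "0 < c" "\<And>\<alpha> T. \<alpha> \<in> growth_rates \<Longrightarrow> 0 < T \<Longrightarrow> c * F T \<le> exp (\<alpha> * T)"
proof -
  obtain c where c: "c > 0" "\<And>s y. 0 \<le> s \<Longrightarrow> y \<in> K \<Longrightarrow> \<exists>\<Phi>\<in>flow_maps \<B> s. c * F s * norm y \<le> e \<bullet> \<Phi> y"
    by (rule uniform_growth) blast
  have e: "0 < norm e" using e_nonzero by simp
  show ?thesis
  proof (rule that[of "c / norm e"])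
    show "0 < c / norm e" using c(1) e by simp
    fix \<alpha> T :: real assume \<alpha>: "\<alpha> \<in> growth_rates" and T: "0 < T"
    define g where "g = c / norm e * F T"
    have g: "0 < g" using F_pos[of T] T c(1) e by (simp add: g_def)
    have step: "\<exists>A. control \<B> A \<and> flow A u T \<in> K \<and> g * norm u \<le> norm (flow A u T)" if u: "u \<in> K" for u
    proof -
      obtain A where A: "control \<B> A" "c * F T * norm u \<le> e \<bullet> flow A u T"
        using c(2)[OF _ u, of T] T by (auto simp: flow_maps_def)
      have "c * F T * norm u \<le> norm (flow A u T) * norm e"
        using A(2) norm_cauchy_schwarz[of e "flow A u T"] by (simp add: mult.commute)
      then have "g * norm u \<le> norm (flow A u T)"
        unfolding g_def using e by (simp add: pos_divide_le_eq)
      then show ?thesis using A(1) flow_in_cone[OF A(1) _ u] T by auto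
    qed
    obtain C where C: "control \<B> C" and
      seg: "\<And>k. \<exists>A. control \<B> A \<and> g * norm (flow C w (real k * T)) \<le> norm (flow A (flow C w (real k * T)) T) \<and>
          (\<forall>t\<in>{0..T}. flow C w (real k * T + t) = flow A (flow C w (real k * T)) t)"
      by (rule flow_chain[OF T w_mem, of "\<lambda>u A. g * norm u \<le> norm (flow A u T)"]) (use step in blast)+
    have low: "g ^ k * norm w \<le> norm (flow C w (real k * T))" for k
    proof (induction k)
      case (Suc k)
      have "g ^ Suc k * norm w \<le> g * norm (flow C w (real k * T))" using Suc g by simp
      also have "\<dots> \<le> norm (flow C w (real k * T + T))" using seg[of k] T by auto
      finally show ?case by (simp add: algebra_simps)
    qed (simp add: flow_0[OF C])
    have "trajectory \<B> (flow C w)" using trajectory_iff_control C flow_solution[OF C] by blast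
    then obtain D where D: "\<And>t. 0 \<le> t \<Longrightarrow> norm (flow C w t) \<le> D * exp (\<alpha> * t)" using \<alpha> by blast
    \<comment> \<open>If \<open>g\<close> were larger, the concatenated trajectory would exceed
      every bound of rate \<open>\<alpha>\<close> after enough periods.\<close>
    have "g \<le> exp (\<alpha> * T)"
    proof (rule ccontr)
      assume "\<not> g \<le> exp (\<alpha> * T)"
      then have "1 < g / exp (\<alpha> * T)" by simp
      then obtain k where k: "D / norm w < (g / exp (\<alpha> * T)) ^ k" using real_arch_pow by blast
      have "g ^ k * norm w \<le> D * exp (\<alpha> * (real k * T))" using low[of k] D[of "real k * T"] T by simp
      also have "exp (\<alpha> * (real k * T)) = exp (\<alpha> * T) ^ k" by (simp add: exp_of_nat_mult[symmetric] mult_ac)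
      finally have "(g / exp (\<alpha> * T)) ^ k \<le> D / norm w"
        using w_nonzero by (simp add: power_divide field_simps)
      with k show False by simp
    qed
    then show "c / norm e * F T \<le> exp (\<alpha> * T)" by (simp add: g_def)
  qed
qed

text \<open>Both bounds are obtained at each single time: \<open>ln (\<kappa> / a * F t) / t\<close>
  is itself a growth rate, hence at least the exponent, and \<open>ln (c * F t) / t\<close> is below
  all growth rates, hence at most the exponent. The same facts show that the infimum is taken over a
  nonempty set that is bounded below.\<close>

lemma F_asymptotics:
  obtains k1 k2 where "0 < k1" "\<And>t. 0 < t \<Longrightarrow> k1 * exp (lyapunov_exponent \<B> * t) \<le> F t"
    "\<And>t. 0 < t \<Longrightarrow> F t \<le> k2 * exp (lyapunov_exponent \<B> * t)"
proof -
  obtain c where c: "0 < c" "\<And>\<alpha> T. \<alpha> \<in> growth_rates \<Longrightarrow> 0 < T \<Longrightarrow> c * F T \<le> exp (\<alpha> * T)"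
    by (rule F_le_growth_rate) blast
  have b: "0 < \<kappa> / a" using a_pos \<kappa>_pos by simp
  have bF: "0 < \<kappa> / a * F t" if "0 < t" for t using b F_pos[of t] that by (intro mult_pos_pos) auto
  have ln_rate: "ln (\<kappa> / a * F t) / t \<in> growth_rates" if t: "0 < t" for t
    by (rule growth_rateI[OF t]) (use bF[OF t] t in simp)
  have lower: "ln (c * F t) / t \<le> \<alpha>" if "\<alpha> \<in> growth_rates" "0 < t" for \<alpha> t
  proof -
    have "0 < c * F t" using c(1) F_pos[of t] that(2) by simp
    then have "ln (c * F t) \<le> ln (exp (\<alpha> * t))" using c(2)[OF that] by (subst ln_le_cancel_iff) auto
    then show ?thesis using that(2) by (simp add: pos_divide_le_eq)
  qed
  have bdd: "bdd_below growth_rates" using lower[of _ 1] by (intro bdd_belowI[of _ "ln (c * F 1) / 1"]) auto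
  have ne: "growth_rates \<noteq> {}" using ln_rate[of 1] by (metis empty_iff zero_less_one)
  have \<sigma>: "lyapunov_exponent \<B> = Inf growth_rates" by (simp add: lyapunov_exponent_def)
  show ?thesis
  proof (rule that[of "a / \<kappa>" "1 / c"])
    show "0 < a / \<kappa>" using a_pos \<kappa>_pos by simp
    fix t :: real assume t: "0 < t"
    have "lyapunov_exponent \<B> \<le> ln (\<kappa> / a * F t) / t" unfolding \<sigma> by (rule cInf_lower[OF ln_rate[OF t] bdd])
    then have "exp (lyapunov_exponent \<B> * t) \<le> exp (ln (\<kappa> / a * F t))" using t by (simp add: pos_le_divide_eq)
    also have "\<dots> = \<kappa> / a * F t" using bF[OF t] by (rule exp_ln)
    finally have "a / \<kappa> * exp (lyapunov_exponent \<B> * t) \<le> a / \<kappa> * (\<kappa> / a * F t)"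
      using a_pos \<kappa>_pos by (intro mult_left_mono) auto
    then show "a / \<kappa> * exp (lyapunov_exponent \<B> * t) \<le> F t" using a_pos \<kappa>_pos by simp
    have "ln (c * F t) / t \<le> lyapunov_exponent \<B>" unfolding \<sigma> by (rule cInf_greatest[OF ne lower[OF _ t]])
    then have "exp (ln (c * F t)) \<le> exp (lyapunov_exponent \<B> * t)" using t by (simp add: pos_divide_le_eq)
    moreover have "0 < c * F t" using c(1) F_pos[of t] t by simp
    ultimately show "F t \<le> 1 / c * exp (lyapunov_exponent \<B> * t)" using c(1) by (simp add: field_simps)
  qed
qed

lemma invariant_monotone_norm_exists: "\<exists>N. invariant_norm K \<B> N \<and> monotone_on_cone K N"
proof -
  define \<sigma> where "\<sigma> = lyapunov_exponent \<B>"
  obtain k1 k2 where k: "0 < k1" "\<And>t. 0 < t \<Longrightarrow> k1 * exp (\<sigma> * t) \<le> F t" "\<And>t. 0 < t \<Longrightarrow> F t \<le> k2 * exp (\<sigma> * t)"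
    unfolding \<sigma>_def by (rule F_asymptotics) blast
  interpret exponential_growth K "flow_maps \<B>" M e w a \<kappa> \<sigma> k1 k2 by unfold_locales (use k in auto)
  interpret hull: bounded_operators "convex hull \<B>" M by (rule bounded_operators_convex_hull)
  have W_flow': "W (flow A x t) \<le> exp (\<sigma> * t) * W x" if "control \<B> A" "0 \<le> t" for A x t
    using that by (intro W_flow[of t "\<lambda>v. flow A v t", simplified]) (auto simp: flow_maps_def)
  obtain k where k: "0 < k" "\<And>x. x \<in> K \<Longrightarrow> k * norm x \<le> W x" by (rule W_lower) blast
  have norm: "norm_on_cone K W" unfolding norm_on_cone_def
  proof (intro conjI ballI allI impI)
    show "0 \<le> W x" if "x \<in> K" for x
      using k(2)[OF that] k(1) by (meson less_imp_le mult_nonneg_nonneg norm_ge_zero order_trans)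
    show "0 < W x" if "x \<in> K - {0}" for x
    proof -
      have "0 < k * norm x" using that k(1) by simp
      also have "\<dots> \<le> W x" using k(2) that by simp
      finally show ?thesis .
    qed
    show "convex_on K W"
    proof (rule convex_onI)
      fix t x y assume t: "0 < t" "t < (1::real)"
      show "W ((1 - t) *\<^sub>R x + t *\<^sub>R y) \<le> (1 - t) * W x + t * W y"
        using W_add[of "(1 - t) *\<^sub>R x" "t *\<^sub>R y"] t by (simp add: W_scale)
    qed (rule K_convex)
  qed (rule W_scale)
  have ext: "extremal_norm K \<B> W" unfolding extremal_norm_def
  proof (intro conjI norm allI impI)
    fix x t assume x: "trajectory \<B> x \<and> x 0 \<in> K" and t: "(0::real) \<le> t"
    then obtain A where A: "control \<B> A" "ode_solution A x" using trajectory_iff_control by blast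
    show "W (x t) \<le> exp (lyapunov_exponent \<B> * t) * W (x 0)"
      unfolding ode_solution_eq_flow[OF A t] using W_flow'[OF A(1) t] by (simp add: \<sigma>_def)
  qed
  \<comment> \<open>Exact growth over one unit of time, with a control in the hull; ending in
    \<open>K\<close> allows the construction to be repeated.\<close>
  have step: "\<exists>A. control (convex hull \<B>) A \<and> flow A u 1 \<in> K \<and>
      (\<forall>t\<in>{0..1}. W (flow A u t) = exp (\<sigma> * t) * W u)" if u: "u \<in> K" for u
  proof -
    \<comment> \<open>The \<open>n\<close>-th control is nearly optimal up to
      \<open>1 / (n + 1)\<close> and is measured by \<open>V n\<close>, so error and tail index
      improve together.\<close>
    have "\<exists>A. control \<B> A \<and> exp \<sigma> * (W u - 1 / real (Suc n)) \<le> V n (flow A u 1)" for n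
    proof -
      obtain \<Phi> where "\<Phi> \<in> flow_maps \<B> 1" "exp \<sigma> * (W u - 1 / real (Suc n)) \<le> V n (\<Phi> u)"
        by (rule V_near_invariant[of "1 / real (Suc n)" u n]) auto
      then show ?thesis by (auto simp: flow_maps_def)
    qed
    then obtain A where A: "\<And>n. control \<B> (A n)" "\<And>n. exp \<sigma> * (W u - 1 / real (Suc n)) \<le> V n (flow (A n) u 1)"
      by metis
    obtain f x r where f: "control (convex hull \<B>) f" "solves_on 1 f x" "x 0 = u" and r: "strict_mono (r :: nat \<Rightarrow> nat)"
      and lim: "\<And>t. t \<in> {0..1} \<Longrightarrow> (\<lambda>n. flow (A (r n)) u t) \<longlonglongrightarrow> x t"
      by (rule relaxed_limit_trajectory[where A = A and T = 1 and v = u, OF compact A(1) zero_le_one]) (rule that)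
    have xf: "flow f u t = x t" if "t \<in> {0..1}" for t
      using hull.solves_on_eq_flow[OF f(1,2), of t] that f(3) by simp
    have "x 1 \<in> K"
      by (rule closed_sequentially[OF K_closed _ lim[of 1]]) (use flow_in_cone[OF A(1) _ u] in auto)
    have Wlim: "(\<lambda>n. W (flow (A (r n)) u t)) \<longlonglongrightarrow> W (x t)" if "t \<in> {0..1}" for t
      by (rule tendsto_of_one_sided_lipschitz[OF W_lipschitz lim[OF that]])
    \<comment> \<open>The index \<open>m\<close> is fixed while \<open>n\<close> grows:
      \<open>V (r n) \<le> V m\<close> transfers the estimates to one continuous function, and the
      infimum over \<open>m\<close> is taken only after the limit.\<close>
    have top: "exp \<sigma> * W u \<le> W (x 1)"
    proof (rule W_greatest)
      fix m
      have Vlim: "(\<lambda>n. V m (flow (A (r n)) u 1)) \<longlonglongrightarrow> V m (x 1)"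
        by (rule tendsto_of_one_sided_lipschitz[OF V_lipschitz lim]) simp
      have "(\<lambda>n. exp \<sigma> * (W u - 1 / real (Suc n))) \<longlonglongrightarrow> exp \<sigma> * (W u - 0)"
        by (intro tendsto_intros LIMSEQ_Suc[OF lim_const_over_n])
      moreover have "exp \<sigma> * (W u - 1 / real (Suc n)) \<le> V m (flow (A (r n)) u 1)" if "m \<le> n" for n
      proof -
        have rn: "n \<le> r n" by (rule seq_suble[OF r])
        have "1 / real (Suc (r n)) \<le> 1 / real (Suc n)" using rn by (intro divide_left_mono) auto
        then have "exp \<sigma> * (W u - 1 / real (Suc n)) \<le> exp \<sigma> * (W u - 1 / real (Suc (r n)))"
          by (intro mult_left_mono) auto
        also have "\<dots> \<le> V (r n) (flow (A (r n)) u 1)" by (rule A(2))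
        also have "\<dots> \<le> V m (flow (A (r n)) u 1)" using rn that by (intro V_antimono) simp
        finally show ?thesis .
      qed
      ultimately show "exp \<sigma> * W u \<le> V m (x 1)"
        using LIMSEQ_le[OF _ Vlim, of "\<lambda>n. exp \<sigma> * (W u - 1 / real (Suc n))" "exp \<sigma> * (W u - 0)"] by auto
    qed
    \<comment> \<open>The norm grows at most exponentially on \<open>{0..t}\<close> and on
      \<open>{t..1}\<close>, while \<open>top\<close> gives the full factor over
      \<open>{0..1}\<close>; hence equality at \<open>t\<close>. The upper bounds are proved for the
      approximating trajectories and passed to the limit, since \<open>W_flow'\<close> concerns
      controls in \<open>\<B>\<close>.\<close>
    have "W (x t) = exp (\<sigma> * t) * W u" if t: "t \<in> {0..1}" for t
    proof (rule antisym)
      have "W (flow (A (r n)) u t) \<le> exp (\<sigma> * t) * W u" for n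
        using t by (intro W_flow' A(1)) auto
      then show "W (x t) \<le> exp (\<sigma> * t) * W u" using LIMSEQ_le_const2[OF Wlim[OF t]] by blast
      have "W (flow (A (r n)) u 1) \<le> exp (\<sigma> * (1 - t)) * W (flow (A (r n)) u t)" for n
        using flow_shift[where s = t and t = "1 - t" and v = u, OF A(1)[of "r n"]]
          W_flow'[where t = "1 - t", OF control_shift[OF A(1)[of "r n"], of t]] t by simp
      then have "W (x 1) \<le> exp (\<sigma> * (1 - t)) * W (x t)"
        using LIMSEQ_le[OF Wlim[of 1] tendsto_mult_left[OF Wlim[OF t]]] by auto
      with top have "exp \<sigma> * W u \<le> exp (\<sigma> * (1 - t)) * W (x t)" by linarith
      then have "exp (\<sigma> * t - \<sigma>) * (exp \<sigma> * W u) \<le> exp (\<sigma> * t - \<sigma>) * (exp (\<sigma> * (1 - t)) * W (x t))"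
        by (intro mult_left_mono) auto
      then show "exp (\<sigma> * t) * W u \<le> W (x t)"
        by (simp add: mult.assoc[symmetric] exp_add[symmetric] algebra_simps)
    qed
    then show ?thesis using f(1) xf \<open>x 1 \<in> K\<close> by (intro exI[of _ f]) auto
  qed
  have "\<exists>x. generalized_trajectory \<B> x \<and> x 0 = u \<and> (\<forall>t\<ge>0. W (x t) = exp (\<sigma> * t) * W u)" if u: "u \<in> K" for u
  proof -
    obtain C where C: "control (convex hull \<B>) C" and
      seg: "\<And>k. \<exists>A. control (convex hull \<B>) A \<and>
          (\<forall>t\<in>{0..1}. W (flow A (flow C u (real k * 1)) t) = exp (\<sigma> * t) * W (flow C u (real k * 1))) \<and>
          (\<forall>t\<in>{0..1}. flow C u (real k * 1 + t) = flow A (flow C u (real k * 1)) t)"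
      by (rule hull.flow_chain[OF zero_less_one u,
            of "\<lambda>u A. \<forall>t\<in>{0..1}. W (flow A u t) = exp (\<sigma> * t) * W u"]) (use step in blast)+
    have seg': "W (flow C u (real k + t)) = exp (\<sigma> * t) * W (flow C u (real k))" if "t \<in> {0..1}" for k t
      using seg[of k] that by auto
    have nat: "W (flow C u (real k)) = exp (\<sigma> * real k) * W u" for k
    proof (induction k)
      case (Suc k)
      have "W (flow C u (real k + 1)) = exp \<sigma> * W (flow C u (real k))" using seg'[of 1 k] by simp
      then show ?case using Suc by (simp add: algebra_simps exp_add)
    qed (simp add: hull.flow_0[OF C])
    have "W (flow C u t) = exp (\<sigma> * t) * W u" if t: "0 \<le> t" for t
    proof -
      define k where "k = nat \<lfloor>t\<rfloor>"
      have k: "t - real k \<in> {0..1}" using t by (auto simp: k_def) linarith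
      then have "W (flow C u t) = exp (\<sigma> * (t - real k)) * (exp (\<sigma> * real k) * W u)"
        using seg'[OF k, of k] nat[of k] by simp
      then show ?thesis by (simp add: mult.assoc[symmetric] exp_add[symmetric] algebra_simps)
    qed
    moreover have "generalized_trajectory \<B> (flow C u)"
      unfolding generalized_trajectory_def trajectory_iff_control using C hull.flow_solution[OF C] by blast
    ultimately show ?thesis using hull.flow_0[OF C] by blast
  qed
  then have "invariant_norm K \<B> W" using ext by (simp add: invariant_norm_def \<sigma>_def)
  moreover have "monotone_on_cone K W" using W_mono by (auto simp: monotone_on_cone_def cone_le_def)
  ultimately show ?thesis by blast
qed

end

theorem theorem3:
  fixes K :: "(real^'d) set" and \<A> :: "(real^'d^'d) set"
  assumes "proper_cone K"
    and "compact \<A>" and "\<A> \<noteq> {}"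
    and "\<forall>A\<in>\<A>. metzler K A"
    and "cone_irreducible K \<A>"
  shows "\<exists>N. invariant_norm K \<A> N \<and> monotone_on_cone K N"
proof -
  have K: "cone K" "convex K" "closed K" "interior K \<noteq> {}" "K \<inter> uminus ` K = {0}"
    using assms(1) by (auto simp: proper_cone_def)
  obtain M where "bounded_operators \<A> M" using compact_imp_bounded_operators[OF assms(2)] .
  then interpret bounded_operators \<A> M .
  obtain e a where e: "a > 0" "\<And>x. x \<in> K \<Longrightarrow> a * norm x \<le> e \<bullet> x"
    by (rule pointed_cone_functional[OF K(1-3,5)]) (rule that)
  obtain w \<kappa> where w: "w \<in> K" "\<kappa> > 0" "\<And>z. (\<kappa> * norm z) *\<^sub>R w - z \<in> K"
    by (rule solid_cone_order_unit[OF K(1,4)]) (rule that)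
  interpret irreducible_metzler_family \<A> M K e w a \<kappa>
    by unfold_locales (fact assms e w)+
  show ?thesis by (rule invariant_monotone_norm_exists)
qed

end
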